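(* Let $S$ be a skew lattice, let $A>B$ be comparable $\mathcal D$-classes of $S$, and let $a\in A$, $b\in B$. Put $A'=B\lor a\lor B$ (the coset of $B$ in $A$ containing $a$) and $B'=A\land b\land A$ (the coset of $A$ in $B$ containing $b$). Then $A'\cup B'$ is a binormal primitive subalgebra of $A\cup B$ that is isomorphic to $\mathbf 2\times A'$, or equivalently to $\mathbf 2\times B'$. Moreover: (i) Each of the $\mathcal D$-classes $A'>B'$ of $A'\cup B'$ is a full coset of the other (that is, $B'$ is a single coset of $A'$ in $B'$, and $A'$ is a single coset of $B'$ in $A'$), and the coset bijection from $A'$ to $B'$ (sending $x\in A'$ to the unique $y\in B'$ with $x\geq y$) is an isomorphism. (ii) The $\mathcal R$-classes of $B'$ are the right cosets $b'\land A$ of $A$ lying in $B'$, and the $\mathcal L$-classes of $B'$ are the left cosets $A\land b'$ of $A$ lying in $B'$ ($b'\in B'$). Dually, the $\mathcal R$-classes of $A'$ are the right cosets $B\lor a'$ of $B$ lying in $A'$, and the $\mathcal L$-classes of $A'$ are the left cosets $a'\lor B$ of $B$ lying in $A'$ ($a'\in A'$). (iii) All right cosets in $A'\cup B'$ are isomorphic. Given right cosets $B\lor a'$ in $A'$ and $b'\land A$ in $B'$ (with $a'\in A'$, $b'\in B'$), an isomorphism from $B\lor a'$ to $b'\land A$ is given by $x\mapsto b'\land x$, with inverse isomorphism $y\mapsto y\lor a'$. For $x\in B\lor a'$, $b'\land x$ is the unique element $y$ of $b'\land A$ such that $y\preceq_L x$; for $y\in b'\land A$, $y\lor a'$ is the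 unique element $x$ of $B\lor a'$ such that $y\preceq_L x$. (iv) Dually, all left cosets in $A'\cup B'$ are isomorphic. Given left cosets $a'\lor B$ in $A'$ and $A\land b'$ in $B'$ (with $a'\in A'$, $b'\in B'$), an isomorphism from $a'\lor B$ to $A\land b'$ is given by $x\mapsto x\land b'$, with inverse isomorphism $y\mapsto a'\lor y$. For $x\in a'\lor B$, $x\land b'$ is the unique element $y$ of $A\land b'$ such that $y\preceq_R x$; for $y\in A\land b'$, $a'\lor y$ is the unique element $x$ of $a'\lor B$ such that $y\preceq_R x$. (v) All left [right, two-sided] cosets of $A$ in $B$ that lie in $B'$ are also cosets of $A'$ in $B'$ of the same type, and all left [right, two-sided] cosets of $B$ in $A$ that lie in $A'$ are also cosets of $B'$ in $A'$ of the same type.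
   Context: A skew lattice is an algebra $(S;\lor,\land)$ where $\land,\lor$ are idempotent associative binary operations satisfying $x\land(x\lor y)=x=(y\lor x)\land x$ and $x\lor(x\land y)=x=(y\land x)\lor x$. Preorders: $x\preceq_R y$ iff $x=y\land x$ (iff $y=y\lor x$); $x\preceq_L y$ iff $x=x\land y$ (iff $y=x\lor y$); $x\le y$ iff both hold; $x\preceq y$ iff $x\land y\land x=x$ (iff $y\lor x\lor y=y$). The equivalences induced by $\preceq_L,\preceq_R,\preceq$ are $\mathcal L,\mathcal R,\mathcal D$; thus $x\mathrel{\mathcal L}y$ iff $x\land y=x$ and $y\land x=y$, and $x\mathrel{\mathcal R}y$ iff $x\land y=y$ and $y\land x=x$. $\mathcal D$ is a congruence, $S/\mathcal D$ is a lattice, and $\mathcal D$-classes are rectangular subalgebras (i.e. $x\land y=y\lor x$ holds in them). For $\mathcal D$-classes, $A>B$ means $A>B$ in the lattice $S/\mathcal D$. Cosets, for $\mathcal D$-classes $A>B$ and $a\in A$, $b\in B$: the (two-sided) coset of $A$ in $B$ containing $b$ is $A\land b\land A=\{x\land b\land x: x\in A\}$; the (two-sided) coset of $B$ in $A$ containing $a$ is $B\lor a\lor B=\{y\lor a\lor y: y\in B\}$. Right cosets: $b\land A=\{b\land x:x\in A\}$ (of $A$ in $B$) and $B\lor a=\{y\lor a:y\in B\}$ (of $B$ in $A$). Left cosets: $A\land b=\{x\land b:x\in A\}$ (of $A$ in $B$) and $a\lor B=\{a\lor y:y\in B\}$ (of $B$ in $A$). A primitive skew lattice is a skew lattice with exactly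 two $\mathcal D$-classes, one strictly above the other. A skew lattice is normal if it satisfies $x\land y\land z\land w=x\land z\land y\land w$, conormal if it satisfies $x\lor y\lor z\lor w=x\lor z\lor y\lor w$, and binormal if it is both normal and conormal. $\mathbf 2$ denotes the two-element lattice. Isomorphisms are isomorphisms of skew lattices. *)

theory Defs
  imports "HOL-Algebra.Congruence"
begin

record 'a skew_alg = "'a partial_object" +
  join :: "['a, 'a] \<Rightarrow> 'a" (infixl "\<squnion>\<index>" 65)
  meet :: "['a, 'a] \<Rightarrow> 'a" (infixl "\<sqinter>\<index>" 70)

locale skew_lattice =
  fixes S (structure)
  assumes join_closed: "\<lbrakk>x \<in> carrier S; y \<in> carrier S\<rbrakk> \<Longrightarrow> x \<squnion> y \<in> carrier S"
    and meet_closed: "\<lbrakk>x \<in> carrier S; y \<in> carrier S\<rbrakk> \<Longrightarrow> x \<sqinter> y \<in> carrier S"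
    and join_idem: "x \<in> carrier S \<Longrightarrow> x \<squnion> x = x"
    and meet_idem: "x \<in> carrier S \<Longrightarrow> x \<sqinter> x = x"
    and join_assoc: "\<lbrakk>x \<in> carrier S; y \<in> carrier S; z \<in> carrier S\<rbrakk>
          \<Longrightarrow> (x \<squnion> y) \<squnion> z = x \<squnion> (y \<squnion> z)"
    and meet_assoc: "\<lbrakk>x \<in> carrier S; y \<in> carrier S; z \<in> carrier S\<rbrakk>
          \<Longrightarrow> (x \<sqinter> y) \<sqinter> z = x \<sqinter> (y \<sqinter> z)"
    and meet_join_absorb: "\<lbrakk>x \<in> carrier S; y \<in> carrier S\<rbrakk> \<Longrightarrow> x \<sqinter> (x \<squnion> y) = x"
    and join_meet_absorb: "\<lbrakk>x \<in> carrier S; y \<in> carrier S\<rbrakk> \<Longrightarrow> (y \<squnion> x) \<sqinter> x = x"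
    and join_meet_absorb': "\<lbrakk>x \<in> carrier S; y \<in> carrier S\<rbrakk> \<Longrightarrow> x \<squnion> (x \<sqinter> y) = x"
    and meet_join_absorb': "\<lbrakk>x \<in> carrier S; y \<in> carrier S\<rbrakk> \<Longrightarrow> (y \<sqinter> x) \<squnion> x = x"

definition preceq_R :: "('a, 'm) skew_alg_scheme \<Rightarrow> 'a \<Rightarrow> 'a \<Rightarrow> bool" where
  "preceq_R S x y \<longleftrightarrow> x = y \<sqinter>\<^bsub>S\<^esub> x"

definition preceq_L :: "('a, 'm) skew_alg_scheme \<Rightarrow> 'a \<Rightarrow> 'a \<Rightarrow> bool" where
  "preceq_L S x y \<longleftrightarrow> x = x \<sqinter>\<^bsub>S\<^esub> y"

definition skew_le :: "('a, 'm) skew_alg_scheme \<Rightarrow> 'a \<Rightarrow> 'a \<Rightarrow> bool" where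
  "skew_le S x y \<longleftrightarrow> preceq_R S x y \<and> preceq_L S x y"

definition skew_less :: "('a, 'm) skew_alg_scheme \<Rightarrow> 'a \<Rightarrow> 'a \<Rightarrow> bool" where
  "skew_less S x y \<longleftrightarrow> skew_le S x y \<and> x \<noteq> y"

definition preceq :: "('a, 'm) skew_alg_scheme \<Rightarrow> 'a \<Rightarrow> 'a \<Rightarrow> bool" where
  "preceq S x y \<longleftrightarrow> x \<sqinter>\<^bsub>S\<^esub> y \<sqinter>\<^bsub>S\<^esub> x = x"

definition rel_L :: "('a, 'm) skew_alg_scheme \<Rightarrow> 'a rel" where
  "rel_L S = {(x, y) \<in> carrier S \<times> carrier S. preceq_L S x y \<and> preceq_L S y x}"

definition rel_R :: "('a, 'm) skew_alg_scheme \<Rightarrow> 'a rel" where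
  "rel_R S = {(x, y) \<in> carrier S \<times> carrier S. preceq_R S x y \<and> preceq_R S y x}"

definition rel_D :: "('a, 'm) skew_alg_scheme \<Rightarrow> 'a rel" where
  "rel_D S = {(x, y) \<in> carrier S \<times> carrier S. preceq S x y \<and> preceq S y x}"

definition L_classes :: "('a, 'm) skew_alg_scheme \<Rightarrow> 'a set set" where
  "L_classes S = carrier S // rel_L S"

definition R_classes :: "('a, 'm) skew_alg_scheme \<Rightarrow> 'a set set" where
  "R_classes S = carrier S // rel_R S"

definition D_classes :: "('a, 'm) skew_alg_scheme \<Rightarrow> 'a set set" where
  "D_classes S = carrier S // rel_D S"

text \<open>
  The lattice \<open>S/\<D>\<close>. Since \<open>\<D>\<close> is a congruence, each of the unions below is a union of copies
  of one and the same \<open>\<D>\<close>-class whenever \<open>X\<close> and \<open>Y\<close> are \<open>\<D>\<close>-classes.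
\<close>

definition D_quotient :: "('a, 'm) skew_alg_scheme \<Rightarrow> 'a set skew_alg" where
  "D_quotient S = \<lparr>carrier = D_classes S,
     join = (\<lambda>X Y. \<Union>x\<in>X. \<Union>y\<in>Y. rel_D S `` {x \<squnion>\<^bsub>S\<^esub> y}),
     meet = (\<lambda>X Y. \<Union>x\<in>X. \<Union>y\<in>Y. rel_D S `` {x \<sqinter>\<^bsub>S\<^esub> y})\<rparr>"

definition D_greater :: "('a, 'm) skew_alg_scheme \<Rightarrow> 'a set \<Rightarrow> 'a set \<Rightarrow> bool" where
  "D_greater S A B \<longleftrightarrow>
     A \<in> D_classes S \<and> B \<in> D_classes S \<and> skew_less (D_quotient S) B A"

definition subalgebra :: "'a set \<Rightarrow> ('a, 'm) skew_alg_scheme \<Rightarrow> bool" where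
  "subalgebra X S \<longleftrightarrow> X \<subseteq> carrier S \<and>
     (\<forall>x\<in>X. \<forall>y\<in>X. x \<squnion>\<^bsub>S\<^esub> y \<in> X \<and> x \<sqinter>\<^bsub>S\<^esub> y \<in> X)"

definition primitive :: "('a, 'm) skew_alg_scheme \<Rightarrow> bool" where
  "primitive S \<longleftrightarrow> skew_lattice S \<and> (\<exists>A B. D_classes S = {A, B} \<and> D_greater S A B)"

definition normal :: "('a, 'm) skew_alg_scheme \<Rightarrow> bool" where
  "normal S \<longleftrightarrow> skew_lattice S \<and>
     (\<forall>x\<in>carrier S. \<forall>y\<in>carrier S. \<forall>z\<in>carrier S. \<forall>w\<in>carrier S.
        x \<sqinter>\<^bsub>S\<^esub> y \<sqinter>\<^bsub>S\<^esub> z \<sqinter>\<^bsub>S\<^esub> w = x \<sqinter>\<^bsub>S\<^esub> z \<sqinter>\<^bsub>S\<^esub> y \<sqinter>\<^bsub>S\<^esub> w)"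

definition conormal :: "('a, 'm) skew_alg_scheme \<Rightarrow> bool" where
  "conormal S \<longleftrightarrow> skew_lattice S \<and>
     (\<forall>x\<in>carrier S. \<forall>y\<in>carrier S. \<forall>z\<in>carrier S. \<forall>w\<in>carrier S.
        x \<squnion>\<^bsub>S\<^esub> y \<squnion>\<^bsub>S\<^esub> z \<squnion>\<^bsub>S\<^esub> w = x \<squnion>\<^bsub>S\<^esub> z \<squnion>\<^bsub>S\<^esub> y \<squnion>\<^bsub>S\<^esub> w)"

definition binormal :: "('a, 'm) skew_alg_scheme \<Rightarrow> bool" where
  "binormal S \<longleftrightarrow> normal S \<and> conormal S"

definition skew_iso :: "('a, 'm) skew_alg_scheme \<Rightarrow> ('b, 'n) skew_alg_scheme \<Rightarrow> ('a \<Rightarrow> 'b) set" where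
  "skew_iso S T = {f. skew_lattice S \<and> skew_lattice T \<and> bij_betw f (carrier S) (carrier T) \<and>
     (\<forall>x\<in>carrier S. \<forall>y\<in>carrier S.
        f (x \<squnion>\<^bsub>S\<^esub> y) = f x \<squnion>\<^bsub>T\<^esub> f y \<and> f (x \<sqinter>\<^bsub>S\<^esub> y) = f x \<sqinter>\<^bsub>T\<^esub> f y)}"

definition skew_isomorphic :: "('a, 'm) skew_alg_scheme \<Rightarrow> ('b, 'n) skew_alg_scheme \<Rightarrow> bool" where
  "skew_isomorphic S T \<longleftrightarrow> skew_iso S T \<noteq> {}"

definition skew_prod :: "('a, 'm) skew_alg_scheme \<Rightarrow> ('b, 'n) skew_alg_scheme \<Rightarrow> ('a \<times> 'b) skew_alg" where
  "skew_prod S T = \<lparr>carrier = carrier S \<times> carrier T,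
     join = (\<lambda>p q. (fst p \<squnion>\<^bsub>S\<^esub> fst q, snd p \<squnion>\<^bsub>T\<^esub> snd q)),
     meet = (\<lambda>p q. (fst p \<sqinter>\<^bsub>S\<^esub> fst q, snd p \<sqinter>\<^bsub>T\<^esub> snd q))\<rparr>"

definition two :: "bool skew_alg" where
  "two = \<lparr>carrier = UNIV, join = (\<or>), meet = (\<and>)\<rparr>"

text \<open>
  Throughout, \<open>A > B\<close> are \<open>\<D>\<close>-classes. The suffix \<open>below\<close> refers to cosets of the upper class
  \<open>A\<close> in the lower class \<open>B\<close> (formed with meets), the suffix \<open>above\<close> to cosets of \<open>B\<close> in \<open>A\<close>
  (formed with joins). In the two-sided cosets the same element is used on both sides.
\<close>

definition coset_below :: "('a, 'm) skew_alg_scheme \<Rightarrow> 'a set \<Rightarrow> 'a \<Rightarrow> 'a set" where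
  "coset_below S A b = {x \<sqinter>\<^bsub>S\<^esub> b \<sqinter>\<^bsub>S\<^esub> x | x. x \<in> A}"

definition coset_above :: "('a, 'm) skew_alg_scheme \<Rightarrow> 'a set \<Rightarrow> 'a \<Rightarrow> 'a set" where
  "coset_above S B a = {y \<squnion>\<^bsub>S\<^esub> a \<squnion>\<^bsub>S\<^esub> y | y. y \<in> B}"

definition right_coset_below :: "('a, 'm) skew_alg_scheme \<Rightarrow> 'a \<Rightarrow> 'a set \<Rightarrow> 'a set" where
  "right_coset_below S b A = {b \<sqinter>\<^bsub>S\<^esub> x | x. x \<in> A}"

definition right_coset_above :: "('a, 'm) skew_alg_scheme \<Rightarrow> 'a set \<Rightarrow> 'a \<Rightarrow> 'a set" where
  "right_coset_above S B a = {y \<squnion>\<^bsub>S\<^esub> a | y. y \<in> B}"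

definition left_coset_below :: "('a, 'm) skew_alg_scheme \<Rightarrow> 'a set \<Rightarrow> 'a \<Rightarrow> 'a set" where
  "left_coset_below S A b = {x \<sqinter>\<^bsub>S\<^esub> b | x. x \<in> A}"

definition left_coset_above :: "('a, 'm) skew_alg_scheme \<Rightarrow> 'a \<Rightarrow> 'a set \<Rightarrow> 'a set" where
  "left_coset_above S a B = {a \<squnion>\<^bsub>S\<^esub> y | y. y \<in> B}"

text \<open>In the families below, the first class is the one whose cosets are taken in the second.\<close>

definition cosets_below :: "('a, 'm) skew_alg_scheme \<Rightarrow> 'a set \<Rightarrow> 'a set \<Rightarrow> 'a set set" where
  "cosets_below S A B = {coset_below S A b | b. b \<in> B}"

definition cosets_above :: "('a, 'm) skew_alg_scheme \<Rightarrow> 'a set \<Rightarrow> 'a set \<Rightarrow> 'a set set" where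
  "cosets_above S B A = {coset_above S B a | a. a \<in> A}"

definition right_cosets_below :: "('a, 'm) skew_alg_scheme \<Rightarrow> 'a set \<Rightarrow> 'a set \<Rightarrow> 'a set set" where
  "right_cosets_below S A B = {right_coset_below S b A | b. b \<in> B}"

definition right_cosets_above :: "('a, 'm) skew_alg_scheme \<Rightarrow> 'a set \<Rightarrow> 'a set \<Rightarrow> 'a set set" where
  "right_cosets_above S B A = {right_coset_above S B a | a. a \<in> A}"

definition left_cosets_below :: "('a, 'm) skew_alg_scheme \<Rightarrow> 'a set \<Rightarrow> 'a set \<Rightarrow> 'a set set" where
  "left_cosets_below S A B = {left_coset_below S A b | b. b \<in> B}"

definition left_cosets_above :: "('a, 'm) skew_alg_scheme \<Rightarrow> 'a set \<Rightarrow> 'a set \<Rightarrow> 'a set set" where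
  "left_cosets_above S B A = {left_coset_above S a B | a. a \<in> A}"

end

theory Submission
  imports Defs
begin

text \<open>
  For \<open>x, x'\<close> in \<open>A\<close> and \<open>b\<close> in \<open>B\<close> absorption forces \<open>x \<sqinter> x' \<sqinter> b = x \<sqinter> b\<close>. Consequently, for every
  \<open>y\<close> in \<open>B'\<close> and \<open>x\<close> in \<open>A\<close>, \<open>x \<sqinter> y \<sqinter> x\<close> depends on \<open>x\<close> alone; call it \<open>down x\<close>. This is the only
  element of \<open>B'\<close> below \<open>x\<close>, \<open>down\<close> is a homomorphism, and \<open>x \<sqinter> y = down x \<sqinter> y\<close>. Together with the
  dual map \<open>up\<close>, which inverts \<open>down\<close> between \<open>A'\<close> and \<open>B'\<close>, this identifies \<open>A' \<union> B'\<close> with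
  \<open>2 \<times> B'\<close> and moves every computation into a single rectangular class. Exchanging the two
  operations (and \<open>A\<close> with \<open>B\<close>) and reversing both operations are symmetries of the situation.
\<close>

section \<open>Comparable rectangular classes\<close>

text \<open>Leaving the operation as a parameter lets \<open>sandwich\<close> and
  \<open>coset\<close> serve both kinds of two-sided coset, as well as the reversed operations used
  in the duality arguments.\<close>

definition sandwich :: "('a \<Rightarrow> 'a \<Rightarrow> 'a) \<Rightarrow> 'a \<Rightarrow> 'a \<Rightarrow> 'a" where
  "sandwich f b x = f (f x b) x"

definition coset :: "('a \<Rightarrow> 'a \<Rightarrow> 'a) \<Rightarrow> 'a \<Rightarrow> 'a set \<Rightarrow> 'a set" where
  "coset f b X = sandwich f b ` X"

text \<open>An elementwise form of two comparable classes. When \<open>y\<close> is taken from the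
  other class, \<open>J_rect_A\<close> and \<open>M_rect_B\<close> say that \<open>B\<close> lies
  below \<open>A\<close>. The list of axioms is invariant under both symmetries, so each result can
  be transported to its duals.\<close>

locale comparable_classes =
  fixes J M :: "'a \<Rightarrow> 'a \<Rightarrow> 'a" and A B :: "'a set"
  assumes disjoint: "A \<inter> B = {}"
    and J_AA: "x \<in> A \<Longrightarrow> y \<in> A \<Longrightarrow> J x y \<in> A"
    and J_AB: "x \<in> A \<Longrightarrow> y \<in> B \<Longrightarrow> J x y \<in> A"
    and J_BA: "x \<in> B \<Longrightarrow> y \<in> A \<Longrightarrow> J x y \<in> A"
    and J_BB: "x \<in> B \<Longrightarrow> y \<in> B \<Longrightarrow> J x y \<in> B"
    and M_AA: "x \<in> A \<Longrightarrow> y \<in> A \<Longrightarrow> M x y \<in> A"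
    and M_AB: "x \<in> A \<Longrightarrow> y \<in> B \<Longrightarrow> M x y \<in> B"
    and M_BA: "x \<in> B \<Longrightarrow> y \<in> A \<Longrightarrow> M x y \<in> B"
    and M_BB: "x \<in> B \<Longrightarrow> y \<in> B \<Longrightarrow> M x y \<in> B"
    and J_assoc: "x \<in> A \<union> B \<Longrightarrow> y \<in> A \<union> B \<Longrightarrow> z \<in> A \<union> B \<Longrightarrow> J (J x y) z = J x (J y z)"
    and M_assoc: "x \<in> A \<union> B \<Longrightarrow> y \<in> A \<union> B \<Longrightarrow> z \<in> A \<union> B \<Longrightarrow> M (M x y) z = M x (M y z)"
    and M_J_absorb: "x \<in> A \<union> B \<Longrightarrow> y \<in> A \<union> B \<Longrightarrow> M x (J x y) = x"
    and M_J_absorb': "x \<in> A \<union> B \<Longrightarrow> y \<in> A \<union> B \<Longrightarrow> M (J y x) x = x"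
    and J_M_absorb: "x \<in> A \<union> B \<Longrightarrow> y \<in> A \<union> B \<Longrightarrow> J x (M x y) = x"
    and J_M_absorb': "x \<in> A \<union> B \<Longrightarrow> y \<in> A \<union> B \<Longrightarrow> J (M y x) x = x"
    and J_rect_A: "x \<in> A \<Longrightarrow> y \<in> A \<union> B \<Longrightarrow> J x (J y x) = x"
    and M_rect_B: "x \<in> B \<Longrightarrow> y \<in> A \<union> B \<Longrightarrow> M x (M y x) = x"
    and M_rect_A: "x \<in> A \<Longrightarrow> y \<in> A \<Longrightarrow> M x (M y x) = x"
    and J_rect_B: "x \<in> B \<Longrightarrow> y \<in> B \<Longrightarrow> J x (J y x) = x"
begin

lemmas closed = J_AA J_AB J_BA J_BB M_AA M_AB M_BA M_BB

section \<open>Symmetries and rectangular identities\<close>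

lemma swap: "comparable_classes M J B A"
  by unfold_locales
    (use disjoint in \<open>auto simp: closed J_assoc M_assoc M_J_absorb M_J_absorb' J_M_absorb
      J_M_absorb' J_rect_A M_rect_B M_rect_A J_rect_B\<close>)

lemma opp: "comparable_classes (\<lambda>x y. J y x) (\<lambda>x y. M y x) A B"
  by unfold_locales
    (use disjoint in \<open>auto simp: closed J_assoc M_assoc M_J_absorb M_J_absorb' J_M_absorb
      J_M_absorb' J_rect_A M_rect_B M_rect_A J_rect_B\<close>)

lemma M_idem: "x \<in> A \<union> B \<Longrightarrow> M x x = x"
  using M_J_absorb[of x "M x x"] J_M_absorb[of x x] by (auto simp: closed)

text \<open>With \<open>p = M y x\<close>, absorption rewrites \<open>x\<close> as
  \<open>p \<squnion> x\<close> and \<open>y\<close> as \<open>y \<squnion> p\<close>;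
  rectangularity of the join then collapses
  \<open>p \<squnion> (x \<squnion> y) \<squnion> p\<close> to \<open>p\<close>.\<close>

lemma J_eq_M_A:
  assumes "x \<in> A" "y \<in> A"
  shows "J x y = M y x"
proof -
  let ?p = "M y x"
  have p: "?p \<in> A" using assms by (simp add: closed)
  have "J x y = J (J ?p x) (J y ?p)"
    using assms J_M_absorb'[of x y] J_M_absorb[of y x] by simp
  also have "\<dots> = J ?p (J (J x y) ?p)"
    using assms p by (simp add: J_assoc closed)
  also have "\<dots> = ?p"
    using assms p by (simp add: J_rect_A closed)
  finally show ?thesis .
qed

lemma J_eq_M_B: "x \<in> B \<Longrightarrow> y \<in> B \<Longrightarrow> J x y = M y x"
  using comparable_classes.J_eq_M_A[OF swap, of y x] by simp

text \<open>Expand \<open>x\<close> to \<open>x \<sqinter> y \<sqinter> x\<close> and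
  \<open>z\<close> to \<open>z \<sqinter> y \<sqinter> z\<close>; the inner part
  \<open>y \<sqinter> (x \<sqinter> z) \<sqinter> y\<close> collapses to \<open>y\<close>.\<close>

lemma M_rect3_A:
  assumes "x \<in> A" "y \<in> A" "z \<in> A"
  shows "M x (M y z) = M x z"
proof -
  have "M x z = M (M x (M y x)) z" using assms by (simp add: M_rect_A)
  also have "\<dots> = M x (M y (M x z))" using assms by (simp add: M_assoc closed)
  also have "\<dots> = M x (M y (M x (M z (M y z))))" using assms by (simp add: M_rect_A)
  also have "\<dots> = M x (M (M y (M (M x z) y)) z)" using assms by (simp add: M_assoc closed)
  also have "\<dots> = M x (M y z)" using assms by (simp add: M_rect_A closed)
  finally show ?thesis by simp
qed

text \<open>With \<open>v = M x x'\<close>, rectangularity gives \<open>v = M v (J v b) = M x (J v b)\<close>; meeting with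
  \<open>b\<close> removes the join by absorption.\<close>

lemma M_AAB:
  assumes "x \<in> A" "x' \<in> A" "b \<in> B"
  shows "M x (M x' b) = M x b"
proof -
  let ?v = "M x x'"
  have v: "?v \<in> A" "J ?v b \<in> A" using assms by (simp_all add: closed)
  have "?v = M ?v (J ?v b)" using assms v by (simp add: M_J_absorb)
  also have "\<dots> = M x (J ?v b)" using assms v by (simp add: M_assoc M_rect3_A)
  finally have "M ?v b = M (M x (J ?v b)) b" by simp
  also have "\<dots> = M x b" using assms v by (simp add: M_assoc M_J_absorb')
  finally show ?thesis using assms by (simp add: M_assoc)
qed

lemma M_BAA:
  assumes "x \<in> A" "x' \<in> A" "b \<in> B"
  shows "M b (M x' x) = M b x"
  using comparable_classes.M_AAB[OF opp] assms by (simp add: M_assoc)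

text \<open>On \<open>B\<close> the meet is the reversed join, and the swapped situation supplies
  the law for joins.\<close>

lemma M_rect3_BB: "x \<in> B \<Longrightarrow> y \<in> B \<Longrightarrow> z \<in> B \<Longrightarrow> M x (M y z) = M x z"
  using comparable_classes.M_rect3_A[OF swap, of z y x]
  by (simp add: J_eq_M_B[symmetric] J_assoc closed)

text \<open>Since \<open>x \<sqinter> y = x \<sqinter> (x \<sqinter> y)\<close>, the middle factor
  may be replaced by \<open>x \<sqinter> y\<close>, which lies in \<open>B\<close> even when
  \<open>y\<close> is in \<open>A\<close>.\<close>

lemma M_rect3_B:
  assumes "x \<in> B" "y \<in> A \<union> B" "z \<in> B"
  shows "M x (M y z) = M x z"
proof -
  have xy: "M x y \<in> B" using assms by (auto simp: closed)
  have "M x (M x y) = M x y"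
    using assms M_assoc[of x x y] by (simp add: M_idem)
  then have "M x (M y z) = M x (M (M x y) z)"
    using assms xy M_assoc[of x y z] M_assoc[of x "M x y" z] by simp
  then show ?thesis using assms xy by (simp add: M_rect3_BB)
qed

end

section \<open>Base points and the maps \<open>down\<close> and \<open>up\<close>\<close>

locale coset_pair = comparable_classes +
  fixes a b
  assumes a: "a \<in> A" and b: "b \<in> B"
begin

abbreviation "down \<equiv> sandwich M b"
abbreviation "up \<equiv> sandwich J a"
abbreviation "A' \<equiv> coset J a B"
abbreviation "B' \<equiv> coset M b A"

lemma swap_pair: "coset_pair M J B A b a"
  by (simp add: coset_pair_def coset_pair_axioms_def swap a b)

lemma opp_pair: "coset_pair (\<lambda>x y. J y x) (\<lambda>x y. M y x) A B a b"
  by (simp add: coset_pair_def coset_pair_axioms_def opp a b)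

lemma down_closed [simp]: "x \<in> A \<Longrightarrow> down x \<in> B'" "x \<in> A \<Longrightarrow> down x \<in> B"
  using b by (auto simp: coset_def sandwich_def closed)

lemmas up_closed [simp] = coset_pair.down_closed[OF swap_pair]

lemma B'E:
  assumes "y \<in> B'"
  obtains x where "x \<in> A" "y = down x"
  using assms by (auto simp: coset_def)

lemma B'_B [dest]: "y \<in> B' \<Longrightarrow> y \<in> B"
  by (auto elim: B'E)

lemmas A'_A [dest] = coset_pair.B'_B[OF swap_pair]

text \<open>Reversing the operation brackets a sandwich the other way. These flips turn facts
  obtained through \<open>opp_pair\<close> back into facts about the same \<open>down\<close>,
  \<open>up\<close>, \<open>A'\<close> and \<open>B'\<close>.\<close>

lemma down_flip: "x \<in> A \<Longrightarrow> sandwich (\<lambda>x y. M y x) b x = down x"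
  using b by (simp add: sandwich_def M_assoc)

lemma up_flip: "y \<in> B \<Longrightarrow> sandwich (\<lambda>x y. J y x) a y = up y"
  using a by (simp add: sandwich_def J_assoc)

lemma B'_flip: "coset (\<lambda>x y. M y x) b A = B'"
  unfolding coset_def by (intro image_cong refl down_flip)

lemma A'_flip: "coset (\<lambda>x y. J y x) a B = A'"
  unfolding coset_def by (intro image_cong refl up_flip)

text \<open>If \<open>y = z \<sqinter> b \<sqinter> z\<close> with \<open>z\<close> in
  \<open>A\<close>, then \<open>M_AAB\<close> and \<open>M_BAA\<close> remove both factors
  \<open>z\<close> from
  \<open>x \<sqinter> z \<sqinter> b \<sqinter> z \<sqinter> x\<close>.\<close>

lemma M_ABA:
  assumes "x \<in> A" "y \<in> B'"
  shows "M x (M y x) = down x"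
proof -
  obtain z where z: "z \<in> A" "y = M (M z b) z" using assms by (auto simp: sandwich_def elim: B'E)
  have "M x (M y x) = M (M x (M z b)) (M z x)"
    using assms z b by (simp add: M_assoc closed)
  also have "\<dots> = M x (M b (M z x))" using assms z b by (simp add: M_AAB M_assoc closed)
  also have "\<dots> = down x" using assms z b by (simp add: M_BAA M_assoc sandwich_def)
  finally show ?thesis .
qed

text \<open>Squaring the idempotent \<open>x \<sqinter> y\<close> exhibits
  \<open>x \<sqinter> y \<sqinter> x\<close>, which is \<open>down x\<close> by
  \<open>M_ABA\<close>.\<close>

lemma M_AB_down:
  assumes "x \<in> A" "y \<in> B'"
  shows "M x y = M (down x) y"
proof -
  have y: "y \<in> B" using assms by auto
  have "M (down x) y = M (M x y) (M x y)"
    using assms y by (simp add: M_ABA[OF assms, symmetric] M_assoc closed)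
  then show ?thesis using assms y by (simp add: M_idem closed)
qed

lemma M_BA_down:
  assumes "x \<in> A" "y \<in> B'"
  shows "M y x = M y (down x)"
  using coset_pair.M_AB_down[OF opp_pair] assms by (simp add: B'_flip down_flip)

text \<open>Both sides equal \<open>x \<sqinter> b \<sqinter> z\<close>: on the right
  \<open>b \<sqinter> (x \<sqinter> z) \<sqinter> b\<close> collapses to \<open>b\<close>, and on
  the left \<open>M_AAB\<close> and \<open>M_BAA\<close> remove the inner factors.\<close>

lemma down_M:
  assumes "x \<in> A" "z \<in> A"
  shows "down (M x z) = M (down x) (down z)"
proof -
  have "M (down x) (down z) = M x (M (M b (M (M x z) b)) z)"
    using assms b by (simp add: sandwich_def M_assoc closed)
  also have "\<dots> = M x (M b z)" using assms b by (simp add: M_rect_B closed)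
  also have "\<dots> = M x (M (M z b) (M x z))"
    using assms b by (simp add: M_assoc M_BAA M_AAB closed)
  also have "\<dots> = down (M x z)"
    using assms b by (simp add: sandwich_def M_assoc closed)
  finally show ?thesis by simp
qed

lemma M_up: "y \<in> B \<Longrightarrow> M (up y) y = y" "y \<in> B \<Longrightarrow> M y (up y) = y"
proof -
  assume y: "y \<in> B"
  show "M (up y) y = y"
    using y a by (simp add: sandwich_def M_J_absorb' closed)
  show "M y (up y) = y"
    using y a by (simp add: sandwich_def M_J_absorb J_assoc closed)
qed

text \<open>By \<open>M_up\<close> the element \<open>y\<close> lies below \<open>up y\<close>, so
  the sandwich of \<open>y\<close> by \<open>up y\<close> is \<open>y\<close>; by
  \<open>M_ABA\<close> it is also \<open>down (up y)\<close>.\<close>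

lemma down_up:
  assumes "y \<in> B'"
  shows "down (up y) = y"
proof -
  have y: "y \<in> B" using assms by auto
  then show ?thesis using M_ABA[of "up y" y] assms by (simp add: M_up)
qed

lemma up_down: "x \<in> A' \<Longrightarrow> up (down x) = x"
  by (rule coset_pair.down_up[OF swap_pair])

text \<open>A join of an element of \<open>A'\<close> with one of \<open>B\<close> is thereby
  computed inside \<open>A\<close>, in the same way as mixed meets are computed inside
  \<open>B\<close>.\<close>

lemmas J_AB_up = coset_pair.M_BA_down[OF swap_pair]
lemmas J_BA_up = coset_pair.M_AB_down[OF swap_pair]

lemma M_B'B': "x \<in> B' \<Longrightarrow> y \<in> B' \<Longrightarrow> M x y \<in> B'"
  by (elim B'E) (simp add: down_M[symmetric] M_AA)

lemma J_B'B': "x \<in> B' \<Longrightarrow> y \<in> B' \<Longrightarrow> J x y \<in> B'"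
  by (simp add: J_eq_M_B[OF B'_B B'_B] M_B'B')

lemma M_AB': "x \<in> A \<Longrightarrow> y \<in> B' \<Longrightarrow> M x y \<in> B'"
  using M_B'B'[of "down x" y] by (simp add: M_AB_down)

lemma M_B'A: "x \<in> A \<Longrightarrow> y \<in> B' \<Longrightarrow> M y x \<in> B'"
  using M_B'B'[of y "down x"] by (simp add: M_BA_down)

lemmas J_A'A' = coset_pair.M_B'B'[OF swap_pair]
lemmas M_A'A' = coset_pair.J_B'B'[OF swap_pair]

lemma down_J: "x \<in> A \<Longrightarrow> z \<in> A \<Longrightarrow> down (J x z) = J (down x) (down z)"
  by (simp add: J_eq_M_A down_M J_eq_M_B)

lemmas up_M = coset_pair.down_J[OF swap_pair]

lemma bij_down: "bij_betw down A' B'"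
  by (rule bij_betwI[where g = up]) (auto simp: up_down down_up)

lemma M_down: "x \<in> A \<Longrightarrow> M x (down x) = down x" "x \<in> A \<Longrightarrow> M (down x) x = down x"
proof -
  assume x: "x \<in> A"
  then have "M x (down x) = M (M x x) (M b x)" "M (down x) x = M x (M b (M x x))"
    using b by (simp_all add: sandwich_def M_assoc closed)
  with x b show "M x (down x) = down x" "M (down x) x = down x"
    by (simp_all add: M_idem sandwich_def M_assoc)
qed

section \<open>The natural order and the cosets inside \<open>A' \<union> B'\<close>\<close>

lemma le_iff:
  assumes "x \<in> A'" "y \<in> B'"
  shows "y = M x y \<and> y = M y x \<longleftrightarrow> y = down x"
proof
  have x: "x \<in> A" using assms by auto
  \<comment> \<open>From \<open>y \<le> x\<close> the sandwich
    \<open>x \<sqinter> y \<sqinter> x\<close> is \<open>y\<close>, while \<open>M_ABA\<close>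
    evaluates it to \<open>down x\<close>.\<close>
  show "y = M x y \<and> y = M y x \<Longrightarrow> y = down x"
    using M_ABA[OF x assms(2)] by metis
  show "y = down x \<Longrightarrow> y = M x y \<and> y = M y x"
    using M_down[OF x] by simp
qed

text \<open>The set \<open>X\<close> may be \<open>A\<close> or \<open>A'\<close>, so the cosets in
  \<open>S\<close> and those in the subalgebra get the same description. An element \<open>z\<close>
  with \<open>y \<sqinter> z = z\<close> is reached as \<open>y \<sqinter> up z\<close>, because
  \<open>down (up z) = z\<close>.\<close>

lemma right_coset_eq:
  assumes "y \<in> B'" "A' \<subseteq> X" "X \<subseteq> A"
  shows "(\<lambda>x. M y x) ` X = {z \<in> B'. M y z = z}"
proof (intro equalityI subsetI)
  fix z assume "z \<in> (\<lambda>x. M y x) ` X"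
  then obtain x where "x \<in> A" "z = M y x" using assms by auto
  moreover have "y \<in> B" using assms by auto
  ultimately show "z \<in> {z \<in> B'. M y z = z}"
    using assms(1) M_assoc[of y y x] by (simp add: M_B'A M_idem)
next
  fix z assume z: "z \<in> {z \<in> B'. M y z = z}"
  then have u: "up z \<in> A'" by auto
  then have "M y (up z) = z"
    using M_BA_down[of "up z" y] assms z by (auto simp: down_up)
  then show "z \<in> (\<lambda>x. M y x) ` X" using u assms by force
qed

lemma left_coset_eq:
  assumes "y \<in> B'" "A' \<subseteq> X" "X \<subseteq> A"
  shows "(\<lambda>x. M x y) ` X = {z \<in> B'. M z y = z}"
  using coset_pair.right_coset_eq[OF opp_pair] assms by (simp add: A'_flip B'_flip)

text \<open>Every sandwich of \<open>y\<close> by \<open>x\<close> equals \<open>down x\<close>, and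
  \<open>down\<close> already maps \<open>A'\<close> onto \<open>B'\<close>.\<close>

lemma coset_eq:
  assumes "y \<in> B'" "A' \<subseteq> X" "X \<subseteq> A"
  shows "coset M y X = B'"
proof -
  have "sandwich M y x = down x" if "x \<in> X" for x
  proof -
    have "x \<in> A" "y \<in> B" using that assms by auto
    then show ?thesis
      using M_ABA[of x y] assms(1) M_assoc[of x y x] by (simp add: sandwich_def[of M y])
  qed
  then have "sandwich M y ` X = down ` X" by simp
  also have "down ` X = B'"
  proof
    show "down ` X \<subseteq> B'" using assms by auto
    show "B' \<subseteq> down ` X" 
      using assms bij_betw_imp_surj_on[OF bij_down] image_mono[of A' X down] by simp
  qed
  finally show ?thesis by (simp add: coset_def)
qed

lemma right_coset_self: "y \<in> B \<Longrightarrow> y \<in> (\<lambda>x. M y x) ` A"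
  by (rule image_eqI[of _ _ "up y"]) (simp_all add: M_up)

lemma left_coset_self: "y \<in> B \<Longrightarrow> y \<in> (\<lambda>x. M x y) ` A"
  by (rule image_eqI[of _ _ "up y"]) (simp_all add: M_up)

lemma coset_self: "y \<in> B \<Longrightarrow> y \<in> coset M y A"
  unfolding coset_def by (rule image_eqI[of _ _ "up y"]) (simp_all add: M_up sandwich_def[of M])

text \<open>If \<open>y\<close> fixes \<open>u\<close> and \<open>v\<close> from the left, then
  \<open>u \<sqinter> v = y \<sqinter> u \<sqinter> v = y \<sqinter> v = v\<close>; the join is the
  reversed meet.\<close>

lemma right_zero_B':
  assumes "y \<in> B'" "x \<in> B'" "z \<in> B'" "M y x = x" "M y z = z"
  shows "M x z = z \<and> J x z = x"
proof -
  have *: "M u v = v" if "u \<in> B'" "v \<in> B'" "M y u = u" "M y v = v" for u v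
  proof -
    have "u \<in> B" "v \<in> B" "y \<in> B" using that assms(1) by auto
    then show ?thesis using M_assoc[of y u v] M_rect3_B[of y u v] that by simp
  qed
  have "x \<in> B" "z \<in> B" using assms by auto
  then show ?thesis using *[of x z] *[of z x] assms by (simp add: J_eq_M_B)
qed

lemma left_zero_B':
  assumes "y \<in> B'" "x \<in> B'" "z \<in> B'" "M x y = x" "M z y = z"
  shows "M x z = x \<and> J x z = z"
  using coset_pair.right_zero_B'[OF opp_pair, of y z x] assms by (simp add: B'_flip)

text \<open>A left zero band for the join is a right zero band for the meet, so swapping the
  operations interchanges the two hands.\<close>

lemmas right_zero_A' = coset_pair.left_zero_B'[OF swap_pair]
lemmas left_zero_A' = coset_pair.right_zero_B'[OF swap_pair]

text \<open>The computation moves into \<open>A\<close>: \<open>up\<close> sends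
  \<open>y' \<sqinter> x\<close> to \<open>up y' \<sqinter> x\<close>, and joining with
  \<open>x'\<close> becomes \<open>x' \<sqinter> up y' \<sqinter> x = x' \<sqinter> x = x \<squnion>
  x' = x\<close>.\<close>

lemma J_M_right_coset:
  assumes "x' \<in> A'" "y' \<in> B'" "x \<in> A'" "J x x' = x"
  shows "J (M y' x) x' = x"
proof -
  have in_classes: "x \<in> A" "x' \<in> A" "y' \<in> B" "M y' x \<in> B"
    using assms by (auto intro: closed)
  then have "J (M y' x) x' = J (up (M y' x)) x'"
    using assms by (simp add: J_BA_up)
  also have "up (M y' x) = M (up y') x"
    using assms in_classes by (simp add: M_BA_down up_M up_down)
  also have "J (M (up y') x) x' = M x' x"
    using in_classes by (simp add: J_eq_M_A M_rect3_A closed)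
  also have "\<dots> = x"
    using assms in_classes by (simp add: J_eq_M_A)
  finally show ?thesis .
qed

lemma J_M_left_coset:
  assumes "x' \<in> A'" "y' \<in> B'" "x \<in> A'" "J x' x = x"
  shows "J x' (M x y') = x"
  using coset_pair.J_M_right_coset[OF opp_pair] assms by (simp add: A'_flip B'_flip)

lemmas M_J_left_coset = coset_pair.J_M_right_coset[OF swap_pair]
lemmas M_J_right_coset = coset_pair.J_M_left_coset[OF swap_pair]

text \<open>After replacing \<open>x\<close> by \<open>down x\<close>, the factor \<open>y\<close>
  in \<open>y' \<sqinter> y \<sqinter> down x\<close> is a middle factor and drops out.\<close>

lemma M_right_coset:
  assumes "y' \<in> B'" "x \<in> A" "y \<in> B'" "M y' y = y"
  shows "M y' x = M y x"
proof -
  have "M y x = M (M y' y) (down x)" using assms by (simp add: M_BA_down)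
  also have "\<dots> = M y' (down x)"
    using assms M_assoc[of y' y "down x"] M_rect3_B[of y' y "down x"] by auto
  finally show ?thesis using assms by (simp add: M_BA_down)
qed

lemma M_left_coset:
  assumes "y' \<in> B'" "x \<in> A" "y \<in> B'" "M y y' = y"
  shows "M x y' = M x y"
  using coset_pair.M_right_coset[OF opp_pair] assms by (simp add: B'_flip)

section \<open>Coordinates on \<open>A' \<union> B'\<close>: the level (membership in
  \<open>A\<close>) and the projection to \<open>B'\<close>\<close>

definition proj :: "'a \<Rightarrow> 'a" where
  "proj x = (if x \<in> A then down x else x)"

lemma proj_B' [simp]: "y \<in> B' \<Longrightarrow> proj y = y"
  using disjoint B'_B by (fastforce simp: proj_def)

lemma proj_A [simp]: "x \<in> A \<Longrightarrow> proj x = down x"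
  by (simp add: proj_def)

lemma proj_in: "x \<in> A' \<union> B' \<Longrightarrow> proj x \<in> B'"
  by (auto simp: proj_def)

lemma proj_M:
  assumes "x \<in> A' \<union> B'" "y \<in> A' \<union> B'"
  shows "proj (M x y) = M (proj x) (proj y)"
  using assms by (elim UnE)
    (simp_all add: A'_A M_AA down_M M_AB' M_AB_down M_B'A M_BA_down M_B'B')

lemma proj_J:
  assumes "x \<in> A' \<union> B'" "y \<in> A' \<union> B'"
  shows "proj (J x y) = J (proj x) (proj y)"
proof -
  \<comment> \<open>In a mixed join \<open>y\<close> may be replaced by \<open>up y\<close>;
    \<open>down\<close> then distributes over the join and undoes \<open>up\<close>.\<close>
  have "down (J x y) = J (down x) y" "down (J y x) = J y (down x)" if "x \<in> A'" "y \<in> B'" for x y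
  proof -
    have *: "x \<in> A" "y \<in> B" using that by auto
    show "down (J x y) = J (down x) y"
      using that * by (simp add: J_AB_up down_J down_up)
    show "down (J y x) = J y (down x)"
      using that * by (simp add: J_BA_up down_J down_up)
  qed
  with assms show ?thesis
    by (elim UnE) (simp_all add: A'_A B'_B J_AA down_J J_AB J_BA J_B'B')
qed

lemma level_M:
  assumes "x \<in> A' \<union> B'" "y \<in> A' \<union> B'"
  shows "M x y \<in> A \<longleftrightarrow> x \<in> A \<and> y \<in> A"
proof -
  have "x \<in> A \<or> x \<in> B" "y \<in> A \<or> y \<in> B" using assms by auto
  moreover have "z \<notin> A" if "z \<in> B" for z using that disjoint by blast
  ultimately show ?thesis by (elim disjE) (simp_all add: closed)
qed

lemma level_J:
  assumes "x \<in> A' \<union> B'" "y \<in> A' \<union> B'"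
  shows "J x y \<in> A \<longleftrightarrow> x \<in> A \<or> y \<in> A"
proof -
  have "x \<in> A \<or> x \<in> B" "y \<in> A \<or> y \<in> B" using assms by auto
  moreover have "z \<notin> A" if "z \<in> B" for z using that disjoint by blast
  ultimately show ?thesis by (elim disjE) (simp_all add: closed)
qed

text \<open>On the upper level \<open>up\<close> recovers \<open>x\<close> from its projection; on
  the lower level the projection is the identity. Identities can therefore be checked in each
  coordinate separately.\<close>

lemma level_proj_inj:
  assumes "x \<in> A' \<union> B'" "y \<in> A' \<union> B'" "x \<in> A \<longleftrightarrow> y \<in> A" "proj x = proj y"
  shows "x = y"
proof (cases "x \<in> A")
  case True
  have "z \<in> A'" if "z \<in> A" "z \<in> A' \<union> B'" for z
    using that disjoint by auto
  then have "x \<in> A'" "y \<in> A'" using assms True by simp_all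
  then have "x = up (proj x)" "y = up (proj y)"
    by (simp_all add: A'_A up_down)
  then show ?thesis using assms by simp
next
  case False
  have "z \<in> B'" if "z \<notin> A" "z \<in> A' \<union> B'" for z
    using that by auto
  then have "x \<in> B'" "y \<in> B'" using assms False by simp_all
  then show ?thesis using assms by simp
qed

lemma M_closed': "x \<in> A' \<union> B' \<Longrightarrow> y \<in> A' \<union> B' \<Longrightarrow> M x y \<in> A' \<union> B'"
  by (elim UnE) (simp_all add: M_A'A' M_AB' M_B'A M_B'B' A'_A)

lemma J_closed': "x \<in> A' \<union> B' \<Longrightarrow> y \<in> A' \<union> B' \<Longrightarrow> J x y \<in> A' \<union> B'"
  using coset_pair.M_closed'[OF swap_pair] by blast

text \<open>The projections of both sides reduce to \<open>proj x \<sqinter> proj w\<close> by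
  rectangularity, and the levels agree because conjunction is commutative.\<close>

lemma M_normal:
  assumes "x \<in> A' \<union> B'" "y \<in> A' \<union> B'" "z \<in> A' \<union> B'" "w \<in> A' \<union> B'"
  shows "M (M (M x y) z) w = M (M (M x z) y) w"
proof (rule level_proj_inj)
  have "proj (M (M (M x y) z) w) = M (proj x) (proj w)"
    if "y \<in> A' \<union> B'" "z \<in> A' \<union> B'" for y z
  proof -
    have "proj x \<in> B" "proj y \<in> B" "proj z \<in> B" "proj w \<in> B"
      using proj_in B'_B assms that by blast+
    moreover have "proj (M (M (M x y) z) w) = M (M (M (proj x) (proj y)) (proj z)) (proj w)"
      using assms that by (simp only: proj_M M_closed')
    ultimately show ?thesis by (simp add: M_assoc M_rect3_B closed)
  qed
  then show "proj (M (M (M x y) z) w) = proj (M (M (M x z) y) w)"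
    using assms by simp
qed (use assms in \<open>auto simp only: M_closed' level_M\<close>)

lemmas J_normal = coset_pair.M_normal[OF swap_pair]

end

section \<open>Skew lattices\<close>

lemma coset_images:
  "coset_below S X y = coset (meet S) y X"
  "coset_above S Y x = coset (join S) x Y"
  "right_coset_below S y X = (\<lambda>x. y \<sqinter>\<^bsub>S\<^esub> x) ` X"
  "right_coset_above S Y x = (\<lambda>y. y \<squnion>\<^bsub>S\<^esub> x) ` Y"
  "left_coset_below S X y = (\<lambda>x. x \<sqinter>\<^bsub>S\<^esub> y) ` X"
  "left_coset_above S x Y = (\<lambda>y. x \<squnion>\<^bsub>S\<^esub> y) ` Y"
  by (auto simp: coset_below_def coset_above_def right_coset_below_def right_coset_above_def
    left_coset_below_def left_coset_above_def coset_def sandwich_def)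

section \<open>Isomorphisms and direct products\<close>

lemma skew_isomorphic_sym:
  assumes "skew_isomorphic S T"
  shows "skew_isomorphic T S"
proof -
  obtain f where f: "f \<in> skew_iso S T" using assms by (auto simp: skew_isomorphic_def)
  then have bij: "bij_betw f (carrier S) (carrier T)"
    and S: "skew_lattice S" and T: "skew_lattice T"
    and hom: "\<And>x y. \<lbrakk>x \<in> carrier S; y \<in> carrier S\<rbrakk> \<Longrightarrow>
      f (x \<squnion>\<^bsub>S\<^esub> y) = f x \<squnion>\<^bsub>T\<^esub> f y \<and> f (x \<sqinter>\<^bsub>S\<^esub> y) = f x \<sqinter>\<^bsub>T\<^esub> f y"
    by (auto simp: skew_iso_def)
  let ?g = "inv_into (carrier S) f"
  have g: "?g x \<in> carrier S" "f (?g x) = x" if "x \<in> carrier T" for x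
    using bij that by (auto simp: bij_betw_def f_inv_into_f inv_into_into)
  have eq: "?g z = w" if "w \<in> carrier S" "f w = z" for w z
    using bij that by (auto simp: bij_betw_def)
  have "?g (x \<squnion>\<^bsub>T\<^esub> y) = ?g x \<squnion>\<^bsub>S\<^esub> ?g y \<and> ?g (x \<sqinter>\<^bsub>T\<^esub> y) = ?g x \<sqinter>\<^bsub>S\<^esub> ?g y"
    if "x \<in> carrier T" "y \<in> carrier T" for x y
    using g that hom[of "?g x" "?g y"]
    by (intro conjI eq) (simp_all add: skew_lattice.join_closed[OF S] skew_lattice.meet_closed[OF S])
  then have "?g \<in> skew_iso T S"
    using bij S T by (simp add: skew_iso_def bij_betw_inv_into)
  then show ?thesis by (auto simp: skew_isomorphic_def)
qed

lemma skew_isomorphic_trans: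
  assumes "skew_isomorphic S T" "skew_isomorphic T U"
  shows "skew_isomorphic S U"
proof -
  obtain f g where f: "f \<in> skew_iso S T" and g: "g \<in> skew_iso T U"
    using assms by (auto simp: skew_isomorphic_def)
  then have "f x \<in> carrier T" if "x \<in> carrier S" for x
    using that by (auto simp: skew_iso_def bij_betw_def)
  with f g have "g \<circ> f \<in> skew_iso S U"
    by (auto simp: skew_iso_def bij_betw_trans)
  then show ?thesis by (auto simp: skew_isomorphic_def)
qed

lemma skew_lattice_two: "skew_lattice two"
  by unfold_locales (auto simp: two_def)

lemma skew_lattice_prod:
  assumes S: "skew_lattice S" and T: "skew_lattice T"
  shows "skew_lattice (skew_prod S T)"
  by unfold_locales
    (auto simp: skew_prod_def
      skew_lattice.join_closed[OF S] skew_lattice.join_closed[OF T]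
      skew_lattice.meet_closed[OF S] skew_lattice.meet_closed[OF T]
      skew_lattice.join_idem[OF S] skew_lattice.join_idem[OF T]
      skew_lattice.meet_idem[OF S] skew_lattice.meet_idem[OF T]
      skew_lattice.join_assoc[OF S] skew_lattice.join_assoc[OF T]
      skew_lattice.meet_assoc[OF S] skew_lattice.meet_assoc[OF T]
      skew_lattice.meet_join_absorb[OF S] skew_lattice.meet_join_absorb[OF T]
      skew_lattice.join_meet_absorb[OF S] skew_lattice.join_meet_absorb[OF T]
      skew_lattice.join_meet_absorb'[OF S] skew_lattice.join_meet_absorb'[OF T]
      skew_lattice.meet_join_absorb'[OF S] skew_lattice.meet_join_absorb'[OF T])

text \<open>Serves to pass from \<open>down\<close> to the map given by a definite description,
  which is known to agree with it on \<open>A'\<close>.\<close>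

lemma skew_iso_cong:
  assumes f: "f \<in> skew_iso T U" and eq: "\<And>x. x \<in> carrier T \<Longrightarrow> f x = g x"
  shows "g \<in> skew_iso T U"
proof -
  have T: "skew_lattice T" using f by (simp add: skew_iso_def)
  have "bij_betw g (carrier T) (carrier U)"
    using f bij_betw_cong[of "carrier T" f g, OF eq] by (simp add: skew_iso_def)
  then show ?thesis
    using f by (simp add: skew_iso_def eq[symmetric] skew_lattice.join_closed[OF T]
      skew_lattice.meet_closed[OF T])
qed

lemma skew_isomorphic_prod:
  assumes R: "skew_lattice R" and TU: "skew_isomorphic T U"
  shows "skew_isomorphic (skew_prod R T) (skew_prod R U)"
proof -
  obtain f where f: "f \<in> skew_iso T U" using TU by (auto simp: skew_isomorphic_def)
  then have T: "skew_lattice T" and U: "skew_lattice U" and bij: "bij_betw f (carrier T) (carrier U)"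
    by (auto simp: skew_iso_def)
  have "bij_betw (map_prod id f) (carrier R \<times> carrier T) (carrier R \<times> carrier U)"
    using bij bij_betw_id by (rule bij_betw_map_prod[rotated])
  then have "map_prod id f \<in> skew_iso (skew_prod R T) (skew_prod R U)"
    using f skew_lattice_prod[OF R T] skew_lattice_prod[OF R U]
    by (auto simp: skew_iso_def skew_prod_def)
  then show ?thesis by (auto simp: skew_isomorphic_def)
qed

section \<open>Duality, the preorder and the \<open>\<D>\<close>-classes\<close>

context skew_lattice
begin

lemma dual: "skew_lattice (S\<lparr>join := meet S, meet := join S\<rparr>)"
  by unfold_locales (simp_all add: join_closed meet_closed join_idem meet_idem join_assoc
    meet_assoc meet_join_absorb join_meet_absorb join_meet_absorb' meet_join_absorb')

lemma subalgebra_skew_lattice: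
  assumes "subalgebra X S"
  shows "skew_lattice (S\<lparr>carrier := X\<rparr>)"
proof -
  have *: "x \<in> carrier S" if "x \<in> X" for x
    using that assms by (auto simp: subalgebra_def)
  show ?thesis
    by unfold_locales (use assms in \<open>simp_all add: * subalgebra_def join_idem meet_idem join_assoc
    meet_assoc meet_join_absorb join_meet_absorb join_meet_absorb' meet_join_absorb'\<close>)
qed

text \<open>For \<open>e = y \<sqinter> x\<close> absorption gives \<open>e \<squnion> y = e\<close>
  and \<open>e \<squnion> x = x\<close>, hence \<open>x = e \<squnion> (y \<squnion> x)\<close>.
  Joining once more with the idempotent \<open>y \<squnion> x\<close> changes nothing.\<close>

lemma preceq_imp_join:
  assumes "x \<in> carrier S" "y \<in> carrier S" "y \<sqinter> x \<sqinter> y = y"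
  shows "x \<squnion> y \<squnion> x = x"
proof -
  let ?e = "y \<sqinter> x"
  have e: "?e \<in> carrier S" using assms by (simp add: meet_closed)
  have "?e \<squnion> y = ?e" using join_meet_absorb'[OF e assms(2)] assms(3) by simp
  moreover have "?e \<squnion> x = x" using assms by (simp add: meet_join_absorb')
  ultimately have eq: "?e \<squnion> (y \<squnion> x) = x"
    using assms e join_assoc[of ?e y x] by simp
  then have "x \<squnion> y \<squnion> x = (?e \<squnion> (y \<squnion> x)) \<squnion> (y \<squnion> x)"
    using assms by (simp add: join_assoc)
  also have "\<dots> = ?e \<squnion> ((y \<squnion> x) \<squnion> (y \<squnion> x))"
    using assms e by (intro join_assoc) (simp_all add: join_closed)
  also have "\<dots> = x"
    using assms eq by (simp only: join_idem join_closed)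
  finally show ?thesis .
qed

lemma join_imp_preceq:
  assumes "x \<in> carrier S" "y \<in> carrier S" "x \<squnion> y \<squnion> x = x"
  shows "y \<sqinter> x \<sqinter> y = y"
  using skew_lattice.preceq_imp_join[OF dual, of y x] assms by simp

text \<open>With \<open>p = x \<sqinter> y \<sqinter> z\<close>, the two hypotheses give \<open>p \<sqinter> x = x\<close>.\<close>

lemma preceq_trans:
  assumes car: "x \<in> carrier S" "y \<in> carrier S" "z \<in> carrier S"
    and xy: "preceq S x y" and yz: "preceq S y z"
  shows "preceq S x z"
proof -
  let ?p = "x \<sqinter> y \<sqinter> z"
  have p: "?p \<in> carrier S" using car by (simp add: meet_closed)
  have 1: "?p \<sqinter> y \<sqinter> x = x"
  proof -
    have "?p \<sqinter> y \<sqinter> x = x \<sqinter> (y \<sqinter> z \<sqinter> y) \<sqinter> x"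
      using car by (simp add: meet_assoc meet_closed)
    then show ?thesis using xy yz by (simp add: preceq_def)
  qed
  have 2: "?p \<sqinter> x = x"
  proof -
    have "?p \<sqinter> (?p \<sqinter> (y \<sqinter> x)) = ?p \<sqinter> (y \<sqinter> x)"
      using car p meet_assoc[of ?p ?p "y \<sqinter> x"] by (simp add: meet_idem meet_closed)
    then show ?thesis using 1 car p by (simp only: meet_assoc meet_closed)
  qed
  have "x \<sqinter> z \<sqinter> x = ?p \<sqinter> x \<sqinter> z \<sqinter> x" using 2 by simp
  also have "\<dots> = x \<sqinter> y \<sqinter> ((z \<sqinter> x) \<sqinter> (z \<sqinter> x))"
    using car by (simp add: meet_assoc meet_closed)
  also have "\<dots> = x \<sqinter> y \<sqinter> (z \<sqinter> x)"
    using car by (simp only: meet_idem meet_closed)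
  also have "\<dots> = x" using 2 car by (simp add: meet_assoc meet_closed)
  finally show ?thesis by (simp add: preceq_def)
qed

lemma equiv_D: "equiv (carrier S) (rel_D S)"
proof (rule equivI)
  show "rel_D S \<subseteq> carrier S \<times> carrier S" by (auto simp: rel_D_def)
  show "refl_on (carrier S) (rel_D S)"
    by (auto simp: refl_on_def rel_D_def preceq_def meet_idem)
  show "sym (rel_D S)" by (auto simp: sym_def rel_D_def)
  show "trans (rel_D S)" by (auto simp: trans_def rel_D_def intro: preceq_trans)
qed

text \<open>In the quotient, \<open>B < A\<close> is an equation between unions of
  \<open>\<D>\<close>-classes. It places mixed meets in \<open>B\<close>, which yields the
  elementwise inequality; the laws for joins follow by \<open>preceq_imp_join\<close> and
  \<open>join_imp_preceq\<close>.\<close>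

lemma D_greater_comparable:
  assumes "D_greater S A B"
  shows "comparable_classes (join S) (meet S) A B"
proof -
  have A: "A \<in> carrier S // rel_D S" and B: "B \<in> carrier S // rel_D S"
    and BA: "B = (\<Union>x\<in>B. \<Union>y\<in>A. rel_D S `` {x \<sqinter> y})"
    and AB: "B = (\<Union>x\<in>A. \<Union>y\<in>B. rel_D S `` {x \<sqinter> y})" and "B \<noteq> A"
    using assms by (auto simp: D_greater_def D_classes_def skew_less_def skew_le_def
      preceq_R_def preceq_L_def D_quotient_def)
  note eqv = equiv_D
  have sub: "X \<subseteq> carrier S" if "X \<in> carrier S // rel_D S" for X
    using that eqv by (auto simp: quotient_def rel_D_def)
  have car: "x \<in> carrier S" if "x \<in> A \<or> x \<in> B" for x
    using that sub[OF A] sub[OF B] by blast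
  have same: "y \<in> X" if "X \<in> carrier S // rel_D S" "x \<in> X" "y \<in> carrier S"
    "x \<sqinter> y \<sqinter> x = x" "y \<sqinter> x \<sqinter> y = y" for X x y
  proof -
    have "(x, y) \<in> rel_D S"
      using that sub by (auto simp: rel_D_def preceq_def)
    then show ?thesis using that(1,2) eqv by (metis in_quotient_imp_closed)
  qed
  have rect: "x \<sqinter> y \<sqinter> x = x" if "X \<in> carrier S // rel_D S" "x \<in> X" "y \<in> X" for X x y
    using in_quotient_imp_in_rel[OF eqv, of X x y] that by (auto simp: rel_D_def preceq_def)
  \<comment> \<open>\<open>B\<close> is the union of the classes of these meets, and each meet lies
    in its own class.\<close>
  have meet_B: "x \<sqinter> y \<in> B" if "x \<in> A \<and> y \<in> B \<or> x \<in> B \<and> y \<in> A" for x y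
  proof -
    have "x \<sqinter> y \<in> rel_D S `` {x \<sqinter> y}"
      using that car eqv by (auto simp: rel_D_def preceq_def meet_idem meet_closed)
    then show ?thesis using that AB BA by blast
  qed
  \<comment> \<open>Rectangularity of \<open>B\<close>, applied to \<open>y\<close> and
    \<open>x \<sqinter> y\<close>, gives
    \<open>y = y \<sqinter> (x \<sqinter> y) \<sqinter> y\<close>; idempotence shortens this to the
    claim.\<close>
  have below: "y \<sqinter> x \<sqinter> y = y" if "x \<in> A" "y \<in> B" for x y
  proof -
    have "y = y \<sqinter> (x \<sqinter> y) \<sqinter> y"
      using rect[OF B that(2) meet_B[of x y]] that by simp
    then show ?thesis using that car by (simp add: meet_assoc meet_idem meet_closed)
  qed
  have above: "x \<squnion> y \<squnion> x = x" if "x \<in> A" "y \<in> B" for x y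
    using that below car preceq_imp_join by simp
  have rect_join: "x \<squnion> y \<squnion> x = x" if "X \<in> carrier S // rel_D S" "x \<in> X" "y \<in> X" for X x y
    using preceq_imp_join rect that sub by blast
  have meet_cl: "x \<sqinter> y \<in> X" if X: "X \<in> carrier S // rel_D S" and xy: "x \<in> X" "y \<in> X" for X x y
  proof (rule same[OF X xy(1)])
    have [simp]: "x \<in> carrier S" "y \<in> carrier S" using xy sub[OF X] by auto
    show "x \<sqinter> y \<in> carrier S" by (simp add: meet_closed)
    have *: "x \<sqinter> (y \<sqinter> x) = x" using rect[OF X xy] by (simp add: meet_assoc)
    have "x \<sqinter> (x \<sqinter> y) = x \<sqinter> y" using meet_assoc[of x x y] by (simp add: meet_idem)
    then show "x \<sqinter> (x \<sqinter> y) \<sqinter> x = x" using * by (simp add: meet_assoc)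
    have "x \<sqinter> y \<sqinter> x \<sqinter> (x \<sqinter> y) = x \<sqinter> (x \<sqinter> y)" using * by (simp add: meet_assoc)
    also have "\<dots> = x \<sqinter> y" by fact
    finally show "x \<sqinter> y \<sqinter> x \<sqinter> (x \<sqinter> y) = x \<sqinter> y" .
  qed
  \<comment> \<open>The hypothesis \<open>x \<squnion> y \<squnion> x = x\<close> covers both
    \<open>y\<close> in the class of \<open>x\<close> and \<open>y\<close> in the lower class. Since
    \<open>rel_D\<close> is defined by meets, the join identities are translated back.\<close>
  have join_cl: "x \<squnion> y \<in> X \<and> y \<squnion> x \<in> X"
    if X: "X \<in> carrier S // rel_D S" and x: "x \<in> X" and y: "y \<in> carrier S"
      and xy: "x \<squnion> y \<squnion> x = x" for X x y
  proof -
    have [simp]: "x \<in> carrier S" "y \<in> carrier S" using x y sub[OF X] by auto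
    have [simp]: "x \<squnion> y \<in> carrier S" "y \<squnion> x \<in> carrier S" by (simp_all add: join_closed)
    have *: "x \<squnion> (y \<squnion> x) = x" using xy by (simp add: join_assoc)
    have "x \<squnion> (x \<squnion> y) = x \<squnion> y" using join_assoc[of x x y] by (simp add: join_idem)
    then have "x \<squnion> (x \<squnion> y) \<squnion> x = x" using xy by simp
    moreover have "x \<squnion> (y \<squnion> x) \<squnion> x = x" using * by (simp add: join_idem)
    ultimately have "(x \<squnion> y) \<sqinter> x \<sqinter> (x \<squnion> y) = x \<squnion> y" "(y \<squnion> x) \<sqinter> x \<sqinter> (y \<squnion> x) = y \<squnion> x"
      by (simp_all add: join_imp_preceq)
    moreover have "x \<sqinter> (x \<squnion> y) \<sqinter> x = x" "x \<sqinter> (y \<squnion> x) \<sqinter> x = x"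
      by (simp_all add: meet_join_absorb join_meet_absorb meet_assoc meet_idem)
    ultimately show ?thesis using same[OF X x] by simp
  qed
  show ?thesis
  proof
    show "A \<inter> B = {}" using quotient_disj[OF eqv A B] \<open>B \<noteq> A\<close> by auto
  qed (auto simp: car join_assoc meet_assoc meet_join_absorb join_meet_absorb
      join_meet_absorb' meet_join_absorb' meet_B
      meet_cl[OF A] meet_cl[OF B] join_cl[OF A] join_cl[OF B]
      above below rect[OF A] rect[OF B] rect_join[OF A] rect_join[OF B] simp flip: meet_assoc join_assoc)
qed

end

section \<open>Cosets in a skew lattice\<close>

text \<open>Each \<open>y\<close> lies in its own coset \<open>F y\<close>, so a coset contained in
  \<open>B'\<close> has its representative there.\<close>

lemma subset_cosets_eq:
  assumes "B' \<subseteq> B" "\<And>y. y \<in> B \<Longrightarrow> y \<in> F y" "\<And>y. y \<in> B' \<Longrightarrow> F y \<subseteq> B'"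
  shows "{C \<in> {F y | y. y \<in> B}. C \<subseteq> B'} = {F y | y. y \<in> B'}"
  using assms by blast

locale skew_coset_pair = skew_lattice S + coset_pair "join S" "meet S" A B a b
  for S (structure) and A B a b +
  assumes A_carrier: "A \<subseteq> carrier S" and B_carrier: "B \<subseteq> carrier S"
begin

text \<open>\<open>l\<close> tells whether the meet is the left or the right projection. Right cosets are right zero
  bands for the meet, so every bijection between two of them is an isomorphism.\<close>

definition zero_band :: "bool \<Rightarrow> 'a set \<Rightarrow> bool" where
  "zero_band l X \<longleftrightarrow> X \<subseteq> carrier S \<and>
     (\<forall>x\<in>X. \<forall>y\<in>X. x \<sqinter> y = (if l then x else y) \<and> x \<squnion> y = (if l then y else x))"

lemma zero_band_iso:
  assumes "zero_band l X" "zero_band l Y" "bij_betw f X Y"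
  shows "f \<in> skew_iso (S\<lparr>carrier := X\<rparr>) (S\<lparr>carrier := Y\<rparr>)"
proof -
  have "subalgebra Z S" if "zero_band l Z" for Z
    using that by (auto simp: zero_band_def subalgebra_def)
  moreover have "f x \<in> Y" if "x \<in> X" for x
    using assms(3) that by (auto simp: bij_betw_def)
  ultimately show ?thesis
    using assms by (auto simp: skew_iso_def subalgebra_skew_lattice zero_band_def)
qed

section \<open>The subalgebras and the \<open>\<D>\<close>-classes of
  \<open>A' \<union> B'\<close>\<close>

lemma subalgebra_AB: "subalgebra (A \<union> B) S"
  using A_carrier B_carrier by (auto simp: subalgebra_def closed)

lemma in_carrier [simp]: "x \<in> A \<Longrightarrow> x \<in> carrier S" "x \<in> B \<Longrightarrow> x \<in> carrier S"
  "x \<in> A' \<Longrightarrow> x \<in> carrier S" "x \<in> B' \<Longrightarrow> x \<in> carrier S"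
  using A_carrier B_carrier by auto

lemma subalgebra_A'B': "subalgebra (A' \<union> B') S"
  unfolding subalgebra_def using M_closed' J_closed' by auto

lemma subalgebra_A': "subalgebra A' S"
  by (auto simp: subalgebra_def J_A'A' M_A'A')

lemma subalgebra_B': "subalgebra B' S"
  by (auto simp: subalgebra_def J_B'B' M_B'B')

lemma binormal_A'B': "binormal (S\<lparr>carrier := A' \<union> B'\<rparr>)"
  using subalgebra_skew_lattice[OF subalgebra_A'B'] M_normal J_normal[unfolded Un_commute[of B' A']]
  by (simp add: binormal_def normal_def conormal_def)

text \<open>Rectangularity relates all of \<open>A'\<close>. For \<open>y\<close> in
  \<open>B'\<close> the sandwich \<open>x \<sqinter> y \<sqinter> x\<close> falls into
  \<open>B\<close> and so cannot be \<open>x\<close>.\<close>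

lemma rel_D_A': "x \<in> A' \<Longrightarrow> rel_D (S\<lparr>carrier := A' \<union> B'\<rparr>) `` {x} = A'"
proof -
  assume x: "x \<in> A'"
  then have xA: "x \<in> A" by auto
  have "preceq S x y" "preceq S y x" if "y \<in> A'" for y
  proof -
    have "y \<in> A" using that by auto
    then show "preceq S x y" "preceq S y x"
      using xA by (simp_all add: preceq_def M_assoc M_rect_A)
  qed
  moreover have "\<not> preceq S x y" if "y \<in> B'" for y
  proof -
    have "y \<in> B" using that by auto
    then have "x \<sqinter> y \<sqinter> x \<in> B" using xA by (simp add: closed)
    then have "x \<sqinter> y \<sqinter> x \<noteq> x" using xA disjoint by auto
    then show ?thesis by (simp add: preceq_def)
  qed
  ultimately show ?thesis
    using x by (auto simp: rel_D_def preceq_def)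
qed

lemma rel_D_B': "x \<in> B' \<Longrightarrow> rel_D (S\<lparr>carrier := A' \<union> B'\<rparr>) `` {x} = B'"
proof -
  assume x: "x \<in> B'"
  then have xB: "x \<in> B" by auto
  have "preceq S x y" "preceq S y x" if "y \<in> B'" for y
  proof -
    have "y \<in> B" using that by auto
    then show "preceq S x y" "preceq S y x"
      using xB by (simp_all add: preceq_def M_assoc M_rect_B)
  qed
  moreover have "\<not> preceq S y x" if "y \<in> A'" for y
  proof -
    have yA: "y \<in> A" using that by auto
    then have "y \<sqinter> x \<sqinter> y \<in> B" using xB by (simp add: closed)
    then have "y \<sqinter> x \<sqinter> y \<noteq> y" using yA disjoint by auto
    then show ?thesis by (simp add: preceq_def)
  qed
  ultimately show ?thesis
    using x by (auto simp: rel_D_def preceq_def)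
qed

lemma nonempty: "up b \<in> A'" "down a \<in> B'"
  using a b by simp_all

lemma D_classes_A'B': "D_classes (S\<lparr>carrier := A' \<union> B'\<rparr>) = {A', B'}"
proof -
  let ?T = "S\<lparr>carrier := A' \<union> B'\<rparr>"
  have "D_classes ?T = (\<lambda>x. rel_D ?T `` {x}) ` (A' \<union> B')"
    by (auto simp: D_classes_def quotient_def)
  also have "\<dots> = (\<lambda>x. A') ` A' \<union> (\<lambda>x. B') ` B'"
    by (simp add: image_Un rel_D_A' rel_D_B')
  also have "\<dots> = {A', B'}" using nonempty by (auto simp: image_constant_conv)
  finally show ?thesis .
qed

lemma D_greater_A'B': "D_greater (S\<lparr>carrier := A' \<union> B'\<rparr>) A' B'"
proof -
  let ?T = "S\<lparr>carrier := A' \<union> B'\<rparr>"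
  have "rel_D ?T `` {x \<sqinter> y} = B'" "rel_D ?T `` {y \<sqinter> x} = B'" if "x \<in> A'" "y \<in> B'" for x y
    using that by (simp_all add: rel_D_B' M_AB' M_B'A A'_A)
  then have "(\<Union>x\<in>A'. \<Union>y\<in>B'. rel_D ?T `` {x \<sqinter> y}) = B'"
    "(\<Union>y\<in>B'. \<Union>x\<in>A'. rel_D ?T `` {y \<sqinter> x}) = B'"
    using nonempty by auto
  moreover have "B' \<noteq> A'"
    using nonempty disjoint by (metis A'_A B'_B disjoint_iff)
  ultimately show ?thesis
    by (simp add: D_greater_def D_classes_A'B' skew_less_def skew_le_def preceq_R_def
      preceq_L_def D_quotient_def)
qed

section \<open>The product decomposition and the coset bijection\<close>

lemma level_proj_iso:
  "(\<lambda>x. (x \<in> A, proj x)) \<in> skew_iso (S\<lparr>carrier := A' \<union> B'\<rparr>) (skew_prod two (S\<lparr>carrier := B'\<rparr>))"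
proof -
  let ?f = "\<lambda>x. (x \<in> A, proj x)"
  have "inj_on ?f (A' \<union> B')"
    by (rule inj_onI, rule level_proj_inj) simp_all
  moreover have "?f ` (A' \<union> B') = UNIV \<times> B'"
  proof
    show "?f ` (A' \<union> B') \<subseteq> UNIV \<times> B'" using proj_in by auto
    show "UNIV \<times> B' \<subseteq> ?f ` (A' \<union> B')"
    proof clarify
      fix l y assume y: "y \<in> B'"
      then have "y \<in> B" by auto
      then have "up y \<in> A" "up y \<in> A'" "y \<notin> A"
        using disjoint by (auto simp only: up_closed disjoint_iff)
      \<comment> \<open>The element of \<open>B'\<close> has two lifts: \<open>up y\<close> on the
        upper level and \<open>y\<close> itself on the lower one.\<close>
      then have "(True, y) = ?f (up y)" "(False, y) = ?f y"
        using y by (simp_all add: down_up)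
      moreover have "up y \<in> A' \<union> B'" "y \<in> A' \<union> B'"
        using y \<open>up y \<in> A'\<close> by simp_all
      ultimately show "(l, y) \<in> ?f ` (A' \<union> B')"
        by (cases l) (simp_all only: image_eqI)
    qed
  qed
  ultimately have "bij_betw ?f (A' \<union> B') (UNIV \<times> B')" by (simp add: bij_betw_def)
  then show ?thesis
    using subalgebra_skew_lattice[OF subalgebra_A'B']
      skew_lattice_prod[OF skew_lattice_two subalgebra_skew_lattice[OF subalgebra_B']]
    by (simp add: skew_iso_def skew_prod_def two_def proj_M proj_J level_M level_J)
qed

lemma down_iso: "down \<in> skew_iso (S\<lparr>carrier := A'\<rparr>) (S\<lparr>carrier := B'\<rparr>)"
  using subalgebra_skew_lattice[OF subalgebra_A'] subalgebra_skew_lattice[OF subalgebra_B'] bij_down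
  by (simp add: skew_iso_def down_J down_M A'_A)

lemma iso_two_B': "skew_isomorphic (S\<lparr>carrier := A' \<union> B'\<rparr>) (skew_prod two (S\<lparr>carrier := B'\<rparr>))"
  using level_proj_iso by (auto simp: skew_isomorphic_def)

lemma iso_two_A': "skew_isomorphic (S\<lparr>carrier := A' \<union> B'\<rparr>) (skew_prod two (S\<lparr>carrier := A'\<rparr>))"
proof -
  have "skew_isomorphic (S\<lparr>carrier := B'\<rparr>) (S\<lparr>carrier := A'\<rparr>)"
    by (rule skew_isomorphic_sym) (use down_iso in \<open>auto simp: skew_isomorphic_def\<close>)
  then show ?thesis
    by (rule skew_isomorphic_trans[OF iso_two_B' skew_isomorphic_prod[OF skew_lattice_two]])
qed

lemma skew_le_iff_down: "x \<in> A' \<Longrightarrow> y \<in> B' \<and> skew_le S y x \<longleftrightarrow> y = down x"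
  using le_iff[of x y] by (auto simp: skew_le_def preceq_R_def preceq_L_def A'_A)

section \<open>Cosets of the full classes and of \<open>A'\<close>, \<open>B'\<close>, described
  together\<close>

lemma coset_below_A': "y \<in> B' \<Longrightarrow> coset_below S A y = B'" "y \<in> B' \<Longrightarrow> coset_below S A' y = B'"
  by (auto simp: coset_images coset_eq A'_A subset_iff)

lemma coset_above_B': "x \<in> A' \<Longrightarrow> coset_above S B x = A'" "x \<in> A' \<Longrightarrow> coset_above S B' x = A'"
  using coset_pair.coset_eq[OF swap_pair, of x] by (auto simp: coset_images B'_B subset_iff)

lemma A'_subset: "A' \<subseteq> A" and B'_subset: "B' \<subseteq> B"
  by auto

lemma right_coset_below_eq:
  assumes "y \<in> B'"
  shows "right_coset_below S y A = {z \<in> B'. y \<sqinter> z = z}"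
    and "right_coset_below S y A' = {z \<in> B'. y \<sqinter> z = z}"
  unfolding coset_images
  by (rule right_coset_eq; use assms A'_subset B'_subset in simp)+

lemma left_coset_below_eq:
  assumes "y \<in> B'"
  shows "left_coset_below S A y = {z \<in> B'. z \<sqinter> y = z}"
    and "left_coset_below S A' y = {z \<in> B'. z \<sqinter> y = z}"
  unfolding coset_images
  by (rule left_coset_eq; use assms A'_subset B'_subset in simp)+

lemma left_coset_above_eq:
  assumes "x \<in> A'"
  shows "left_coset_above S x B = {z \<in> A'. x \<squnion> z = z}"
    and "left_coset_above S x B' = {z \<in> A'. x \<squnion> z = z}"
  unfolding coset_images
  by (rule coset_pair.right_coset_eq[OF swap_pair]; use assms A'_subset B'_subset in simp)+

lemma right_coset_above_eq:
  assumes "x \<in> A'"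
  shows "right_coset_above S B x = {z \<in> A'. z \<squnion> x = z}"
    and "right_coset_above S B' x = {z \<in> A'. z \<squnion> x = z}"
  unfolding coset_images
  by (rule coset_pair.left_coset_eq[OF swap_pair]; use assms A'_subset B'_subset in simp)+

lemma zero_bandI:
  assumes "X \<subseteq> carrier S"
    and "\<And>x y. x \<in> X \<Longrightarrow> y \<in> X \<Longrightarrow> x \<sqinter> y = (if l then x else y) \<and> x \<squnion> y = (if l then y else x)"
  shows "zero_band l X"
  using assms by (simp only: zero_band_def) blast

lemma zero_band_right_coset_below:
  assumes "y \<in> B'"
  shows "zero_band False (right_coset_below S y A)"
  unfolding right_coset_below_eq(1)[OF assms]
  by (rule zero_bandI, simp add: subset_iff,
    simp only: if_False mem_Collect_eq, rule right_zero_B'[OF assms], simp_all)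

lemma zero_band_left_coset_below:
  assumes "y \<in> B'"
  shows "zero_band True (left_coset_below S A y)"
  unfolding left_coset_below_eq(1)[OF assms]
  by (rule zero_bandI, simp add: subset_iff,
    simp only: if_True mem_Collect_eq, rule left_zero_B'[OF assms], simp_all)

lemma zero_band_right_coset_above:
  assumes "x \<in> A'"
  shows "zero_band False (right_coset_above S B x)"
  unfolding right_coset_above_eq(1)[OF assms]
  by (rule zero_bandI, simp add: subset_iff,
    simp only: if_False mem_Collect_eq, subst conj_commute, rule right_zero_A'[OF assms], simp_all)

lemma zero_band_left_coset_above:
  assumes "x \<in> A'"
  shows "zero_band True (left_coset_above S x B)"
  unfolding left_coset_above_eq(1)[OF assms]
  by (rule zero_bandI, simp add: subset_iff,
    simp only: if_True mem_Collect_eq, subst conj_commute, rule left_zero_A'[OF assms], simp_all)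

lemma cosets_below_self:
  assumes "y \<in> B"
  shows "y \<in> right_coset_below S y A" "y \<in> left_coset_below S A y" "y \<in> coset_below S A y"
  using assms by (simp_all only: coset_images right_coset_self left_coset_self coset_self)

lemma cosets_above_self:
  assumes "x \<in> A"
  shows "x \<in> right_coset_above S B x" "x \<in> left_coset_above S x B" "x \<in> coset_above S B x"
  using assms by (simp_all only: coset_images coset_pair.left_coset_self[OF swap_pair]
      coset_pair.right_coset_self[OF swap_pair] coset_pair.coset_self[OF swap_pair])

lemma subset_cosets_B':
  "{C \<in> right_cosets_below S A B. C \<subseteq> B'} = {right_coset_below S y A | y. y \<in> B'}"
  "{C \<in> left_cosets_below S A B. C \<subseteq> B'} = {left_coset_below S A y | y. y \<in> B'}"
  "{C \<in> cosets_below S A B. C \<subseteq> B'} = {coset_below S A y | y. y \<in> B'}"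
  unfolding right_cosets_below_def left_cosets_below_def cosets_below_def
  by (rule subset_cosets_eq; use B'_subset cosets_below_self right_coset_below_eq
    left_coset_below_eq coset_below_A' in auto)+

lemma subset_cosets_A':
  "{C \<in> right_cosets_above S B A. C \<subseteq> A'} = {right_coset_above S B x | x. x \<in> A'}"
  "{C \<in> left_cosets_above S B A. C \<subseteq> A'} = {left_coset_above S x B | x. x \<in> A'}"
  "{C \<in> cosets_above S B A. C \<subseteq> A'} = {coset_above S B x | x. x \<in> A'}"
  unfolding right_cosets_above_def left_cosets_above_def cosets_above_def
  by (rule subset_cosets_eq; use A'_subset cosets_above_self right_coset_above_eq
    left_coset_above_eq coset_above_B' in auto)+

section \<open>Green's classes as one-sided cosets\<close>

lemma R_classes_B': "R_classes (S\<lparr>carrier := B'\<rparr>) = {right_coset_below S y A | y. y \<in> B'}"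
proof -
  have "rel_R (S\<lparr>carrier := B'\<rparr>) `` {y} = right_coset_below S y A" if y: "y \<in> B'" for y
  proof -
    \<comment> \<open>Half of the relation suffices: substituting \<open>y \<sqinter> z = z\<close>
      into \<open>y \<sqinter> z \<sqinter> y = y\<close> gives the other half.\<close>
    have "z \<sqinter> y = y" if "y \<sqinter> z = z" "z \<in> B'" for z
    proof -
      have "y \<in> B" "z \<in> B" using y that by auto
      then have "(y \<sqinter> z) \<sqinter> y = y" by (simp add: M_assoc M_rect_B)
      then show ?thesis using that by simp
    qed
    then show ?thesis
      using y by (auto simp: right_coset_below_eq rel_R_def preceq_R_def)
  qed
  then show ?thesis by (auto simp: R_classes_def quotient_def)
qed

lemma L_classes_B': "L_classes (S\<lparr>carrier := B'\<rparr>) = {left_coset_below S A y | y. y \<in> B'}"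
proof -
  have "rel_L (S\<lparr>carrier := B'\<rparr>) `` {y} = left_coset_below S A y" if y: "y \<in> B'" for y
  proof -
    have "y \<sqinter> z = y" if "z \<sqinter> y = z" "z \<in> B'" for z
    proof -
      have "y \<in> B" "z \<in> B" using y that by auto
      then have "y \<sqinter> (z \<sqinter> y) = y" by (simp add: M_rect_B)
      then show ?thesis using that by simp
    qed
    then show ?thesis
      using y by (auto simp: left_coset_below_eq rel_L_def preceq_L_def)
  qed
  then show ?thesis by (auto simp: L_classes_def quotient_def)
qed

text \<open>The coset is described by a join, but on \<open>A\<close> one has
  \<open>z \<squnion> x = x \<sqinter> z\<close>; rectangularity again supplies the second half of
  the relation.\<close>

lemma R_classes_A': "R_classes (S\<lparr>carrier := A'\<rparr>) = {right_coset_above S B x | x. x \<in> A'}"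
proof -
  have "rel_R (S\<lparr>carrier := A'\<rparr>) `` {x} = right_coset_above S B x" if x: "x \<in> A'" for x
  proof -
    have "z = x \<sqinter> z \<and> x = z \<sqinter> x \<longleftrightarrow> z \<squnion> x = z" if "z \<in> A'" for z
    proof -
      have "x \<in> A" "z \<in> A" using x that by auto
      then have "z \<squnion> x = x \<sqinter> z" "(x \<sqinter> z) \<sqinter> x = x"
        by (simp_all add: M_assoc M_rect_A J_eq_M_A)
      then show ?thesis by metis
    qed
    then show ?thesis
      using x by (auto simp: right_coset_above_eq rel_R_def preceq_R_def)
  qed
  then show ?thesis by (auto simp: R_classes_def quotient_def)
qed

lemma L_classes_A': "L_classes (S\<lparr>carrier := A'\<rparr>) = {left_coset_above S x B | x. x \<in> A'}"
proof -
  have "rel_L (S\<lparr>carrier := A'\<rparr>) `` {x} = left_coset_above S x B" if x: "x \<in> A'" for x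
  proof -
    have "z = z \<sqinter> x \<and> x = x \<sqinter> z \<longleftrightarrow> x \<squnion> z = z" if "z \<in> A'" for z
    proof -
      have "x \<in> A" "z \<in> A" using x that by auto
      then have "x \<squnion> z = z \<sqinter> x" "x \<sqinter> (z \<sqinter> x) = x"
        by (simp_all add: M_rect_A J_eq_M_A)
      then show ?thesis by metis
    qed
    then show ?thesis
      using x by (auto simp: left_coset_above_eq rel_L_def preceq_L_def)
  qed
  then show ?thesis by (auto simp: L_classes_def quotient_def)
qed

section \<open>Isomorphisms between one-sided cosets\<close>

lemma right_coset_maps:
  assumes "x' \<in> A'" "y' \<in> B'"
  shows "x \<in> right_coset_above S B x' \<Longrightarrow> y' \<sqinter> x \<in> right_coset_below S y' A"
    and "y \<in> right_coset_below S y' A \<Longrightarrow> y \<squnion> x' \<in> right_coset_above S B x'"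
    and "x \<in> right_coset_above S B x' \<Longrightarrow> (y' \<sqinter> x) \<squnion> x' = x"
    and "y \<in> right_coset_below S y' A \<Longrightarrow> y' \<sqinter> (y \<squnion> x') = y"
proof -
  show "y' \<sqinter> x \<in> right_coset_below S y' A" if "x \<in> right_coset_above S B x'"
    using that unfolding right_coset_above_eq(1)[OF assms(1)] by (auto simp: right_coset_below_def)
  show "y \<squnion> x' \<in> right_coset_above S B x'" if "y \<in> right_coset_below S y' A"
    using that unfolding right_coset_below_eq(1)[OF assms(2)] by (auto simp: right_coset_above_def)
  show "(y' \<sqinter> x) \<squnion> x' = x" if "x \<in> right_coset_above S B x'"
    using that J_M_right_coset[OF assms] unfolding right_coset_above_eq(1)[OF assms(1)] by simp
  show "y' \<sqinter> (y \<squnion> x') = y" if "y \<in> right_coset_below S y' A"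
    using that M_J_right_coset[OF assms(2,1)] unfolding right_coset_below_eq(1)[OF assms(2)] by simp
qed

lemma left_coset_maps:
  assumes "x' \<in> A'" "y' \<in> B'"
  shows "x \<in> left_coset_above S x' B \<Longrightarrow> x \<sqinter> y' \<in> left_coset_below S A y'"
    and "y \<in> left_coset_below S A y' \<Longrightarrow> x' \<squnion> y \<in> left_coset_above S x' B"
    and "x \<in> left_coset_above S x' B \<Longrightarrow> x' \<squnion> (x \<sqinter> y') = x"
    and "y \<in> left_coset_below S A y' \<Longrightarrow> (x' \<squnion> y) \<sqinter> y' = y"
proof -
  show "x \<sqinter> y' \<in> left_coset_below S A y'" if "x \<in> left_coset_above S x' B"
    using that unfolding left_coset_above_eq(1)[OF assms(1)] by (auto simp: left_coset_below_def)
  show "x' \<squnion> y \<in> left_coset_above S x' B" if "y \<in> left_coset_below S A y'"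
    using that unfolding left_coset_below_eq(1)[OF assms(2)] by (auto simp: left_coset_above_def)
  show "x' \<squnion> (x \<sqinter> y') = x" if "x \<in> left_coset_above S x' B"
    using that J_M_left_coset[OF assms] unfolding left_coset_above_eq(1)[OF assms(1)] by simp
  show "(x' \<squnion> y) \<sqinter> y' = y" if "y \<in> left_coset_below S A y'"
    using that M_J_left_coset[OF assms(2,1)] unfolding left_coset_below_eq(1)[OF assms(2)] by simp
qed

text \<open>Both cosets are zero bands of the same hand, so it is enough that the two maps are
  mutually inverse.\<close>

lemma right_coset_isos:
  assumes "x' \<in> A'" "y' \<in> B'"
  shows "(\<lambda>x. y' \<sqinter> x) \<in> skew_iso (S\<lparr>carrier := right_coset_above S B x'\<rparr>)
      (S\<lparr>carrier := right_coset_below S y' A\<rparr>)"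
    and "(\<lambda>y. y \<squnion> x') \<in> skew_iso (S\<lparr>carrier := right_coset_below S y' A\<rparr>)
      (S\<lparr>carrier := right_coset_above S B x'\<rparr>)"
proof -
  note maps = right_coset_maps[OF assms]
  note zero = zero_band_right_coset_below[OF assms(2)] zero_band_right_coset_above[OF assms(1)]
  show "(\<lambda>x. y' \<sqinter> x) \<in> skew_iso (S\<lparr>carrier := right_coset_above S B x'\<rparr>)
      (S\<lparr>carrier := right_coset_below S y' A\<rparr>)"
    by (rule zero_band_iso[OF zero(2,1)], rule bij_betwI[where g = "\<lambda>y. y \<squnion> x'"])
      (simp_all add: maps)
  show "(\<lambda>y. y \<squnion> x') \<in> skew_iso (S\<lparr>carrier := right_coset_below S y' A\<rparr>)
      (S\<lparr>carrier := right_coset_above S B x'\<rparr>)"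
    by (rule zero_band_iso[OF zero(1,2)], rule bij_betwI[where g = "\<lambda>x. y' \<sqinter> x"])
      (simp_all add: maps)
qed

lemma left_coset_isos:
  assumes "x' \<in> A'" "y' \<in> B'"
  shows "(\<lambda>x. x \<sqinter> y') \<in> skew_iso (S\<lparr>carrier := left_coset_above S x' B\<rparr>)
      (S\<lparr>carrier := left_coset_below S A y'\<rparr>)"
    and "(\<lambda>y. x' \<squnion> y) \<in> skew_iso (S\<lparr>carrier := left_coset_below S A y'\<rparr>)
      (S\<lparr>carrier := left_coset_above S x' B\<rparr>)"
proof -
  note maps = left_coset_maps[OF assms]
  note zero = zero_band_left_coset_below[OF assms(2)] zero_band_left_coset_above[OF assms(1)]
  show "(\<lambda>x. x \<sqinter> y') \<in> skew_iso (S\<lparr>carrier := left_coset_above S x' B\<rparr>)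
      (S\<lparr>carrier := left_coset_below S A y'\<rparr>)"
    by (rule zero_band_iso[OF zero(2,1)], rule bij_betwI[where g = "\<lambda>y. x' \<squnion> y"])
      (simp_all add: maps)
  show "(\<lambda>y. x' \<squnion> y) \<in> skew_iso (S\<lparr>carrier := left_coset_below S A y'\<rparr>)
      (S\<lparr>carrier := left_coset_above S x' B\<rparr>)"
    by (rule zero_band_iso[OF zero(1,2)], rule bij_betwI[where g = "\<lambda>x. x \<sqinter> y'"])
      (simp_all add: maps)
qed

text \<open>By \<open>M_right_coset\<close> the meet \<open>y \<sqinter> x\<close> is the same for
  all \<open>y\<close> in the coset, namely \<open>y' \<sqinter> x\<close>.\<close>

lemma right_coset_preceq_L:
  assumes "x \<in> A" "y' \<in> B'" "y \<in> right_coset_below S y' A"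
  shows "preceq_L S y x \<longleftrightarrow> y = y' \<sqinter> x"
  using assms(3) M_right_coset[OF assms(2,1), of y] unfolding right_coset_below_eq(1)[OF assms(2)]
  by (simp add: preceq_L_def)

lemma left_coset_preceq_R:
  assumes "x \<in> A" "y' \<in> B'" "y \<in> left_coset_below S A y'"
  shows "preceq_R S y x \<longleftrightarrow> y = x \<sqinter> y'"
  using assms(3) M_left_coset[OF assms(2,1), of y] unfolding left_coset_below_eq(1)[OF assms(2)]
  by (simp add: preceq_R_def)

text \<open>The second equivalence is the first one solved for \<open>x\<close> by means of the
  inverse map.\<close>

lemma right_coset_unique:
  assumes "x' \<in> A'" "y' \<in> B'"
  shows "x \<in> right_coset_above S B x' \<Longrightarrow>
      y \<in> right_coset_below S y' A \<and> preceq_L S y x \<longleftrightarrow> y = y' \<sqinter> x"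
    and "y \<in> right_coset_below S y' A \<Longrightarrow>
      x \<in> right_coset_above S B x' \<and> preceq_L S y x \<longleftrightarrow> x = y \<squnion> x'"
proof -
  note maps = right_coset_maps[OF assms]
  have A: "x \<in> A" if "x \<in> right_coset_above S B x'" for x
    using that unfolding right_coset_above_eq(1)[OF assms(1)] by auto
  show "y \<in> right_coset_below S y' A \<and> preceq_L S y x \<longleftrightarrow> y = y' \<sqinter> x"
    if "x \<in> right_coset_above S B x'"
    using that A[of x] right_coset_preceq_L[of x y' y] assms(2) maps(1) by auto
  show "x \<in> right_coset_above S B x' \<and> preceq_L S y x \<longleftrightarrow> x = y \<squnion> x'"
    if "y \<in> right_coset_below S y' A"
    using that A[of x] right_coset_preceq_L[of x y' y] assms(2) maps(2)[of y] maps(3)[of x] maps(4)[of y]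
    by auto
qed

lemma left_coset_unique:
  assumes "x' \<in> A'" "y' \<in> B'"
  shows "x \<in> left_coset_above S x' B \<Longrightarrow>
      y \<in> left_coset_below S A y' \<and> preceq_R S y x \<longleftrightarrow> y = x \<sqinter> y'"
    and "y \<in> left_coset_below S A y' \<Longrightarrow>
      x \<in> left_coset_above S x' B \<and> preceq_R S y x \<longleftrightarrow> x = x' \<squnion> y"
proof -
  note maps = left_coset_maps[OF assms]
  have A: "x \<in> A" if "x \<in> left_coset_above S x' B" for x
    using that unfolding left_coset_above_eq(1)[OF assms(1)] by auto
  show "y \<in> left_coset_below S A y' \<and> preceq_R S y x \<longleftrightarrow> y = x \<sqinter> y'"
    if "x \<in> left_coset_above S x' B"
    using that A[of x] left_coset_preceq_R[of x y' y] assms(2) maps(1) by auto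
  show "x \<in> left_coset_above S x' B \<and> preceq_R S y x \<longleftrightarrow> x = x' \<squnion> y"
    if "y \<in> left_coset_below S A y'"
    using that A[of x] left_coset_preceq_R[of x y' y] assms(2) maps(2)[of y] maps(3)[of x] maps(4)[of y]
    by auto
qed

lemma disjoint_union_subset:
  assumes "C \<subseteq> A' \<union> B'"
  shows "C \<subseteq> B \<Longrightarrow> C \<subseteq> B'" and "C \<subseteq> A \<Longrightarrow> C \<subseteq> A'"
proof -
  show "C \<subseteq> B'" if "C \<subseteq> B"
  proof
    fix z assume "z \<in> C"
    then have "z \<in> A' \<union> B'" "z \<notin> A" using assms that disjoint by blast+
    then show "z \<in> B'" using A'_A by (simp only: Un_iff) blast
  qed
  show "C \<subseteq> A'" if "C \<subseteq> A"
  proof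
    fix z assume "z \<in> C"
    then have "z \<in> A' \<union> B'" "z \<notin> B" using assms that disjoint by blast+
    then show "z \<in> A'" using B'_B by (simp only: Un_iff) blast
  qed
qed

text \<open>Comparison with one fixed coset, that of \<open>up b\<close>, makes any two right cosets
  isomorphic by symmetry and transitivity.\<close>

lemma right_cosets_isomorphic:
  assumes "C \<in> right_cosets_below S A B \<union> right_cosets_above S B A" "C \<subseteq> A' \<union> B'"
  shows "skew_isomorphic (S\<lparr>carrier := C\<rparr>) (S\<lparr>carrier := right_coset_above S B (up b)\<rparr>)"
proof -
  have iso: "skew_isomorphic (S\<lparr>carrier := right_coset_below S y A\<rparr>)
      (S\<lparr>carrier := right_coset_above S B x\<rparr>)" if "x \<in> A'" "y \<in> B'" for x y
    using right_coset_isos(2)[OF that] by (auto simp: skew_isomorphic_def)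
  from assms(1) show ?thesis
  proof
    assume C: "C \<in> right_cosets_below S A B"
    then have "C \<subseteq> B" by (auto simp: right_cosets_below_def right_coset_below_def closed)
    then have "C \<in> {C \<in> right_cosets_below S A B. C \<subseteq> B'}"
      using C disjoint_union_subset[OF assms(2)] by simp
    then show ?thesis using iso nonempty unfolding subset_cosets_B' by auto
  next
    assume C: "C \<in> right_cosets_above S B A"
    then have "C \<subseteq> A" by (auto simp: right_cosets_above_def right_coset_above_def closed)
    then have "C \<in> {C \<in> right_cosets_above S B A. C \<subseteq> A'}"
      using C disjoint_union_subset[OF assms(2)] by simp
    then obtain x where x: "x \<in> A'" "C = right_coset_above S B x" unfolding subset_cosets_A' by auto
    \<comment> \<open>A coset in \<open>A'\<close> is compared with the fixed one by going down to a
      coset in \<open>B'\<close> and up again.\<close>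
    show ?thesis unfolding x
      by (rule skew_isomorphic_trans[OF skew_isomorphic_sym[OF iso] iso])
        (use x nonempty in simp_all)
  qed
qed

lemma left_cosets_isomorphic:
  assumes "C \<in> left_cosets_below S A B \<union> left_cosets_above S B A" "C \<subseteq> A' \<union> B'"
  shows "skew_isomorphic (S\<lparr>carrier := C\<rparr>) (S\<lparr>carrier := left_coset_above S (up b) B\<rparr>)"
proof -
  have iso: "skew_isomorphic (S\<lparr>carrier := left_coset_below S A y\<rparr>)
      (S\<lparr>carrier := left_coset_above S x B\<rparr>)" if "x \<in> A'" "y \<in> B'" for x y
    using left_coset_isos(2)[OF that] by (auto simp: skew_isomorphic_def)
  from assms(1) show ?thesis
  proof
    assume C: "C \<in> left_cosets_below S A B"
    then have "C \<subseteq> B" by (auto simp: left_cosets_below_def left_coset_below_def closed)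
    then have "C \<in> {C \<in> left_cosets_below S A B. C \<subseteq> B'}"
      using C disjoint_union_subset[OF assms(2)] by simp
    then show ?thesis using iso nonempty unfolding subset_cosets_B' by auto
  next
    assume C: "C \<in> left_cosets_above S B A"
    then have "C \<subseteq> A" by (auto simp: left_cosets_above_def left_coset_above_def closed)
    then have "C \<in> {C \<in> left_cosets_above S B A. C \<subseteq> A'}"
      using C disjoint_union_subset[OF assms(2)] by simp
    then obtain x where x: "x \<in> A'" "C = left_coset_above S x B" unfolding subset_cosets_A' by auto
    show ?thesis unfolding x
      by (rule skew_isomorphic_trans[OF skew_isomorphic_sym[OF iso] iso])
        (use x nonempty in simp_all)
  qed
qed

section \<open>The elements below, primitivity, and the cosets formed in the subalgebra\<close>

lemma ex1_below: "x \<in> A' \<Longrightarrow> \<exists>!y. y \<in> B' \<and> skew_le S y x"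
  by (simp add: skew_le_iff_down)

lemma the_below_iso:
  "(\<lambda>x. THE y. y \<in> B' \<and> skew_le S y x) \<in> skew_iso (S\<lparr>carrier := A'\<rparr>) (S\<lparr>carrier := B'\<rparr>)"
  by (rule skew_iso_cong[OF down_iso]) (simp add: skew_le_iff_down)

lemma primitive_A'B': "primitive (S\<lparr>carrier := A' \<union> B'\<rparr>)"
  using D_classes_A'B' D_greater_A'B' subalgebra_skew_lattice[OF subalgebra_A'B']
  unfolding primitive_def by blast

lemma coset_carrier_update:
  "coset_below (S\<lparr>carrier := U\<rparr>) X y = coset_below S X y"
  "coset_above (S\<lparr>carrier := U\<rparr>) Y x = coset_above S Y x"
  "right_coset_below (S\<lparr>carrier := U\<rparr>) y X = right_coset_below S y X"
  "right_coset_above (S\<lparr>carrier := U\<rparr>) Y x = right_coset_above S Y x"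
  "left_coset_below (S\<lparr>carrier := U\<rparr>) X y = left_coset_below S X y"
  "left_coset_above (S\<lparr>carrier := U\<rparr>) x Y = left_coset_above S x Y"
  by (simp_all add: coset_images)

lemma full_cosets:
  "cosets_below (S\<lparr>carrier := A' \<union> B'\<rparr>) A' B' = {B'}"
  "cosets_above (S\<lparr>carrier := A' \<union> B'\<rparr>) B' A' = {A'}"
  using nonempty coset_below_A'(2) coset_above_B'(2)
  unfolding cosets_below_def cosets_above_def coset_carrier_update by blast+

text \<open>Part (v) in the sharper form of equalities: for representatives in \<open>A'\<close> or
  \<open>B'\<close>, the coset taken with the full class and the one taken with its subset have the
  same description.\<close>

lemma cosets_in_subalgebra:
  "left_cosets_below (S\<lparr>carrier := A' \<union> B'\<rparr>) A' B' = {C \<in> left_cosets_below S A B. C \<subseteq> B'}"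
  "right_cosets_below (S\<lparr>carrier := A' \<union> B'\<rparr>) A' B' = {C \<in> right_cosets_below S A B. C \<subseteq> B'}"
  "cosets_below (S\<lparr>carrier := A' \<union> B'\<rparr>) A' B' = {C \<in> cosets_below S A B. C \<subseteq> B'}"
  "left_cosets_above (S\<lparr>carrier := A' \<union> B'\<rparr>) B' A' = {C \<in> left_cosets_above S B A. C \<subseteq> A'}"
  "right_cosets_above (S\<lparr>carrier := A' \<union> B'\<rparr>) B' A' = {C \<in> right_cosets_above S B A. C \<subseteq> A'}"
  "cosets_above (S\<lparr>carrier := A' \<union> B'\<rparr>) B' A' = {C \<in> cosets_above S B A. C \<subseteq> A'}"
  unfolding subset_cosets_B' subset_cosets_A'
  unfolding left_cosets_below_def right_cosets_below_def
    cosets_below_def left_cosets_above_def right_cosets_above_def cosets_above_def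
    setcompr_eq_image coset_carrier_update
  by (rule image_cong; simp add: left_coset_below_eq right_coset_below_eq coset_below_A'
    left_coset_above_eq right_coset_above_eq coset_above_B')+

lemma subalgebra_in_AB: "subalgebra (A' \<union> B') (S\<lparr>carrier := A \<union> B\<rparr>)"
  using subalgebra_A'B' Un_mono[OF A'_subset B'_subset] by (simp add: subalgebra_def)

end

theorem theorem2p5:
  fixes S :: "('a, 'm) skew_alg_scheme" (structure)
    and A B A' B' :: "'a set" and a b :: 'a
  assumes "skew_lattice S"
    and "A \<in> D_classes S" and "B \<in> D_classes S" and "D_greater S A B"
    and "a \<in> A" and "b \<in> B"
    and "A' = coset_above S B a"
    and "B' = coset_below S A b"
  shows
    "subalgebra (A \<union> B) S \<and>
     subalgebra (A' \<union> B') (S\<lparr>carrier := A \<union> B\<rparr>) \<and>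
     binormal (S\<lparr>carrier := A' \<union> B'\<rparr>) \<and>
     primitive (S\<lparr>carrier := A' \<union> B'\<rparr>) \<and>
     skew_isomorphic (S\<lparr>carrier := A' \<union> B'\<rparr>) (skew_prod two (S\<lparr>carrier := A'\<rparr>)) \<and>
     skew_isomorphic (S\<lparr>carrier := A' \<union> B'\<rparr>) (skew_prod two (S\<lparr>carrier := B'\<rparr>)) \<and>

     \<comment> \<open>(i)\<close>
     (D_classes (S\<lparr>carrier := A' \<union> B'\<rparr>) = {A', B'} \<and>
      D_greater (S\<lparr>carrier := A' \<union> B'\<rparr>) A' B' \<and>
      cosets_below (S\<lparr>carrier := A' \<union> B'\<rparr>) A' B' = {B'} \<and>
      cosets_above (S\<lparr>carrier := A' \<union> B'\<rparr>) B' A' = {A'} \<and>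
      (\<forall>x\<in>A'. \<exists>!y. y \<in> B' \<and> skew_le S y x) \<and>
      (\<lambda>x. THE y. y \<in> B' \<and> skew_le S y x)
        \<in> skew_iso (S\<lparr>carrier := A'\<rparr>) (S\<lparr>carrier := B'\<rparr>)) \<and>

     \<comment> \<open>(ii)\<close>
     (R_classes (S\<lparr>carrier := B'\<rparr>) = {right_coset_below S b' A | b'. b' \<in> B'} \<and>
      R_classes (S\<lparr>carrier := B'\<rparr>) = {C \<in> right_cosets_below S A B. C \<subseteq> B'} \<and>
      L_classes (S\<lparr>carrier := B'\<rparr>) = {left_coset_below S A b' | b'. b' \<in> B'} \<and>
      L_classes (S\<lparr>carrier := B'\<rparr>) = {C \<in> left_cosets_below S A B. C \<subseteq> B'} \<and>
      R_classes (S\<lparr>carrier := A'\<rparr>) = {right_coset_above S B a' | a'. a' \<in> A'} \<and>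
      R_classes (S\<lparr>carrier := A'\<rparr>) = {C \<in> right_cosets_above S B A. C \<subseteq> A'} \<and>
      L_classes (S\<lparr>carrier := A'\<rparr>) = {left_coset_above S a' B | a'. a' \<in> A'} \<and>
      L_classes (S\<lparr>carrier := A'\<rparr>) = {C \<in> left_cosets_above S B A. C \<subseteq> A'}) \<and>

     \<comment> \<open>(iii)\<close>
     ((\<forall>C \<in> right_cosets_below S A B \<union> right_cosets_above S B A.
       \<forall>D \<in> right_cosets_below S A B \<union> right_cosets_above S B A.
         C \<subseteq> A' \<union> B' \<and> D \<subseteq> A' \<union> B' \<longrightarrow>
         skew_isomorphic (S\<lparr>carrier := C\<rparr>) (S\<lparr>carrier := D\<rparr>)) \<and>
      (\<forall>a'\<in>A'. \<forall>b'\<in>B'.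
         (\<lambda>x. b' \<sqinter> x) \<in> skew_iso (S\<lparr>carrier := right_coset_above S B a'\<rparr>)
                                   (S\<lparr>carrier := right_coset_below S b' A\<rparr>) \<and>
         (\<lambda>y. y \<squnion> a') \<in> skew_iso (S\<lparr>carrier := right_coset_below S b' A\<rparr>)
                                   (S\<lparr>carrier := right_coset_above S B a'\<rparr>) \<and>
         (\<forall>x \<in> right_coset_above S B a'. (b' \<sqinter> x) \<squnion> a' = x) \<and>
         (\<forall>y \<in> right_coset_below S b' A. b' \<sqinter> (y \<squnion> a') = y) \<and>
         (\<forall>x \<in> right_coset_above S B a'. \<forall>y.
            y \<in> right_coset_below S b' A \<and> preceq_L S y x \<longleftrightarrow> y = b' \<sqinter> x) \<and>
         (\<forall>y \<in> right_coset_below S b' A. \<forall>x.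
            x \<in> right_coset_above S B a' \<and> preceq_L S y x \<longleftrightarrow> x = y \<squnion> a'))) \<and>

     \<comment> \<open>(iv)\<close>
     ((\<forall>C \<in> left_cosets_below S A B \<union> left_cosets_above S B A.
       \<forall>D \<in> left_cosets_below S A B \<union> left_cosets_above S B A.
         C \<subseteq> A' \<union> B' \<and> D \<subseteq> A' \<union> B' \<longrightarrow>
         skew_isomorphic (S\<lparr>carrier := C\<rparr>) (S\<lparr>carrier := D\<rparr>)) \<and>
      (\<forall>a'\<in>A'. \<forall>b'\<in>B'.
         (\<lambda>x. x \<sqinter> b') \<in> skew_iso (S\<lparr>carrier := left_coset_above S a' B\<rparr>)
                                   (S\<lparr>carrier := left_coset_below S A b'\<rparr>) \<and>
         (\<lambda>y. a' \<squnion> y) \<in> skew_iso (S\<lparr>carrier := left_coset_below S A b'\<rparr>)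
                                   (S\<lparr>carrier := left_coset_above S a' B\<rparr>) \<and>
         (\<forall>x \<in> left_coset_above S a' B. a' \<squnion> (x \<sqinter> b') = x) \<and>
         (\<forall>y \<in> left_coset_below S A b'. (a' \<squnion> y) \<sqinter> b' = y) \<and>
         (\<forall>x \<in> left_coset_above S a' B. \<forall>y.
            y \<in> left_coset_below S A b' \<and> preceq_R S y x \<longleftrightarrow> y = x \<sqinter> b') \<and>
         (\<forall>y \<in> left_coset_below S A b'. \<forall>x.
            x \<in> left_coset_above S a' B \<and> preceq_R S y x \<longleftrightarrow> x = a' \<squnion> y))) \<and>

     \<comment> \<open>(v)\<close>
     ((\<forall>C \<in> left_cosets_below S A B. C \<subseteq> B' \<longrightarrow>
         C \<in> left_cosets_below (S\<lparr>carrier := A' \<union> B'\<rparr>) A' B') \<and>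
      (\<forall>C \<in> right_cosets_below S A B. C \<subseteq> B' \<longrightarrow>
         C \<in> right_cosets_below (S\<lparr>carrier := A' \<union> B'\<rparr>) A' B') \<and>
      (\<forall>C \<in> cosets_below S A B. C \<subseteq> B' \<longrightarrow>
         C \<in> cosets_below (S\<lparr>carrier := A' \<union> B'\<rparr>) A' B') \<and>
      (\<forall>C \<in> left_cosets_above S B A. C \<subseteq> A' \<longrightarrow>
         C \<in> left_cosets_above (S\<lparr>carrier := A' \<union> B'\<rparr>) B' A') \<and>
      (\<forall>C \<in> right_cosets_above S B A. C \<subseteq> A' \<longrightarrow>
         C \<in> right_cosets_above (S\<lparr>carrier := A' \<union> B'\<rparr>) B' A') \<and>
      (\<forall>C \<in> cosets_above S B A. C \<subseteq> A' \<longrightarrow>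
         C \<in> cosets_above (S\<lparr>carrier := A' \<union> B'\<rparr>) B' A'))"
proof -
  interpret skew_lattice S by fact
  interpret comparable_classes "join S" "meet S" A B
    by (rule D_greater_comparable) fact
  have "A \<subseteq> carrier S" "B \<subseteq> carrier S"
    using assms(2,3) in_quotient_imp_subset[OF equiv_D] by (simp_all add: D_classes_def)
  then interpret skew_coset_pair S A B a b
    using assms(5,6) by unfold_locales
  have A': "A' = coset (join S) a B" and B': "B' = coset (meet S) b A"
    using assms(7,8) by (simp_all only: coset_images)
  \<comment> \<open>Two cosets are linked through the fixed reference coset.\<close>
  note isos_R = skew_isomorphic_trans[OF right_cosets_isomorphic
      skew_isomorphic_sym[OF right_cosets_isomorphic]]
  note isos_L = skew_isomorphic_trans[OF left_cosets_isomorphic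
      skew_isomorphic_sym[OF left_cosets_isomorphic]]
  show ?thesis
    unfolding A' B'
    apply (intro conjI)
    apply (rule subalgebra_AB subalgebra_in_AB binormal_A'B' primitive_A'B'
        iso_two_A' iso_two_B' D_classes_A'B' D_greater_A'B' full_cosets ballI[OF ex1_below]
        the_below_iso R_classes_A' R_classes_B' L_classes_A' L_classes_B'
        R_classes_A'[folded subset_cosets_A'] R_classes_B'[folded subset_cosets_B']
        L_classes_A'[folded subset_cosets_A'] L_classes_B'[folded subset_cosets_B'], assumption?)+
    subgoal by (intro ballI impI, elim conjE) (rule isos_R; assumption)
    subgoal
      apply (intro ballI)
      subgoal premises prems for x y
        using right_coset_isos[OF prems] right_coset_maps(3,4)[OF prems] right_coset_unique[OF prems]
        by (intro conjI ballI allI; simp)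
      done
    subgoal by (intro ballI impI, elim conjE) (rule isos_L; assumption)
    subgoal
      apply (intro ballI)
      subgoal premises prems for x y
        using left_coset_isos[OF prems] left_coset_maps(3,4)[OF prems] left_coset_unique[OF prems]
        by (intro conjI ballI allI; simp)
      done
    by (simp_all add: cosets_in_subalgebra)
qed

end
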